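(* Let $m\ge1$ and consider the singular discrete linear Hamiltonian system $$J\Delta y(n)=(P(n)+\lambda W(n))R(y)(n),\quad n\in\mathbb{Z},\qquad J=\begin{pmatrix}0&-I_m\\ I_m&0\end{pmatrix},\qquad (\ast)$$ where $\Delta y(n)=y(n+1)-y(n)$; $R(y)(n)=(u^T(n+1),v^T(n))^T$ for $y(n)=(u^T(n),v^T(n))^T$ with $u(n),v(n)\in\mathbb{C}^m$; $W(n)=\operatorname{diag}\{W_1(n),W_2(n)\}$ with $m\times m$ Hermitian blocks $W_i(n)\ge0$, $i=1,2$; and $P(n)=\begin{pmatrix}-C(n)&A^*(n)\\ A(n)&B(n)\end{pmatrix}$ is $2m\times 2m$ Hermitian with $m\times m$ matrices $A(n),B(n),C(n)$. Assume: (i) $I_m-A(n)$ is invertible for every $n\in\mathbb{Z}$; (ii) there exist integers $s_0^l\le t_0^l\le 0$ and $1\le s_0^r\le t_0^r$ such that for every $\lambda\in\mathbb{C}$ every nontrivial solution $y$ of $(\ast)$ satisfies $$\sum_{n=s_0^l}^{t_0^l}R(y)^*(n)W(n)R(y)(n)>0,\qquad \sum_{n=s_0^r}^{t_0^r}R(y)^*(n)W(n)R(y)(n)>0.$$ Assume that $(\ast)$ is in the limit circle case at $\pm\infty$. Let $M,N$ be $2m\times 2m$ complex matrices with $\operatorname{rank}(M,N)=2m$ and $MJM^*=NJN^*$, and let $\mathcal{T}_D$ be the self-adjoint linear relation $$\mathcal{T}_D=\left\{(y,g)\in\mathcal{T}: M\begin{pmatrix}(y,\theta_1)_d(-\infty)\\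 \vdots\\ (y,\theta_{2m})_d(-\infty)\end{pmatrix}-N\begin{pmatrix}(y,\theta_1)_d(+\infty)\\ \vdots\\ (y,\theta_{2m})_d(+\infty)\end{pmatrix}=0\right\}.$$ Let $\lambda_*$ be an eigenvalue of $\mathcal{T}_D$. Then the analytic multiplicity of $\lambda_*$ (its order as a zero of the entire function $\Gamma_d(\lambda)=\det(M\Theta_\lambda(-\infty)-N\Theta_\lambda(+\infty))$) and the geometric multiplicity of $\lambda_*$ (the dimension of $N(\mathcal{T}_D-\lambda_* I)$) are equal.
   Context: Spaces. $\hat l^2_W(\mathbb{Z})$ is the set of sequences $\{\hat f(n)\}_{n\in\mathbb{Z}}\subset\mathbb{C}^{2m}$ with $\sum_{n\in\mathbb{Z}}R(\hat f)^*(n)W(n)R(\hat f)(n)<\infty$, with semi-inner product $\langle\hat y,\hat z\rangle_d=\sum_{n\in\mathbb{Z}}R(\hat z)^*(n)W(n)R(\hat y)(n)$ and seminorm $\|\cdot\|_d$; $l^2_W(\mathbb{Z})=\hat l^2_W(\mathbb{Z})/\{\hat y:\|\hat y\|_d=0\}$. Here $^*$ is the conjugate transpose. Linear relations. A linear relation $T$ in a Hilbert space $X$ is a linear subspace of $X^2$. $T^*=\{(h,k)\in X^2:\langle g,h\rangle=\langle f,k\rangle\text{ for all }(f,g)\in T\}$, and $T$ is self-adjoint if $T=T^*$. $D(T)=\{f:(f,g)\in T\text{ for some }g\}$, $N(T)=\{f:(f,0)\in T\}$, $T-\lambda I=\{(f,g-\lambda f):(f,g)\in T\}$. $\lambda$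 is an eigenvalue of $T$ if $N(T-\lambda I)\ne\{0\}$. Maximal relation. With $l(\hat y)(n)=J\Delta\hat y(n)-P(n)R(\hat y)(n)$, $\mathcal{T}$ is the set of $(y,g)\in(l^2_W(\mathbb{Z}))^2$ for which there is $\hat y\in y$ with $l(\hat y)(n)=W(n)R(\hat g)(n)$, $n\in\mathbb{Z}$, for any $\hat g\in g$. Under (i) and (ii) this $\hat y$ is unique, and $y\in D(\mathcal{T})$ is identified with it. The minimal relation $\mathcal{T}_0$ is the closure of the set $\mathcal{T}_{00}$ of $(y,g)\in\mathcal{T}$ whose $\hat y$ vanishes outside a finite set of integers. For $x,y\in D(\mathcal{T})$, $(x,y)_d(n)=y^*(n)Jx(n)$, $n\in\mathbb{Z}$; the limits $(x,y)_d(\pm\infty)=\lim_{n\to\pm\infty}(x,y)_d(n)$ exist and are finite. Limit circle. $(\ast)$ is in the limit circle case at $+\infty$ (resp. $-\infty$) if the minimal linear relation associated with $(\ast)$ on the right half-line $n\ge1$ (resp. the left half-line $n\le 0$) has both defect indices equal to $2m$, i.e. for all $\lambda\in\mathbb{C}\setminus\mathbb{R}$ all solutions $y$ of $(\ast)$ satisfy $\sum_{n\ge1}R(y)^*(n)W(n)R(y)(n)<\infty$ (resp. $\sum_{n\le0}R(y)^*(n)W(n)R(y)(n)<\infty$). When both endpoints are in the limit circle case, for every $\lambda\in\mathbb{C}$ all solutions of $(\ast)$ lie in $\hat l^2_W(\mathbb{Z})$. Fundamental solutions. $\theta_{i,\lambda}$, $1\le i\le 2m$, are the solutions of $(\ast)$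 with $(\theta_{1,\lambda}(0),\dots,\theta_{2m,\lambda}(0))=I_{2m}$, and $\theta_i=\theta_{i,0}$. For $n\in\mathbb{Z}\cup\{\pm\infty\}$, $\Theta_\lambda(n)$ is the $2m\times2m$ matrix whose $(j,i)$ entry is $(\theta_{i,\lambda},\theta_j)_d(n)$; for each fixed $n\in\mathbb{Z}\cup\{\pm\infty\}$ its entries are entire functions of $\lambda$. Known facts. The relations $\mathcal{T}_D$ of the form in the claim are exactly the self-adjoint linear relation extensions of $\mathcal{T}_0$; the spectrum of $\mathcal{T}_D$ consists of isolated eigenvalues; $\lambda\in\mathbb{C}$ is an eigenvalue of $\mathcal{T}_D$ if and only if $\Gamma_d(\lambda)=0$. *)

theory Defs
  imports
    "HOL-Complex_Analysis.Complex_Analysis"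
    "Jordan_Normal_Form.Missing_VectorSpace"
begin

section \<open>Vectors and matrices\<close>

text \<open>
  The index type \<^typ>\<open>'m + 'm\<close> stands for \<open>{1, \<dots>, 2m}\<close>, with \<open>m = CARD('m)\<close>:
  \<open>y $ Inl j\<close> and \<open>y $ Inr j\<close> are the components of \<open>u\<close> and \<open>v\<close> in \<open>y = (u, v)\<close>.
\<close>

type_synonym 'm cvec2 = "complex ^ ('m + 'm)"
type_synonym 'm cmat2 = "complex ^ ('m + 'm) ^ ('m + 'm)"
type_synonym 'm cseq = "int \<Rightarrow> 'm cvec2"

definition cadjoint :: "complex ^ 'n ^ 'k \<Rightarrow> complex ^ 'k ^ 'n" where
  "cadjoint X = (\<chi> i j. cnj (X $ j $ i))"

text \<open>The scalar \<open>x\<^sup>* y\<close>.\<close>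

definition hdot :: "complex ^ 'n \<Rightarrow> complex ^ 'n \<Rightarrow> complex" where
  "hdot x y = (\<Sum>i\<in>UNIV. cnj (x $ i) * y $ i)"

definition hermitian :: "complex ^ 'n ^ 'n \<Rightarrow> bool" where
  "hermitian X \<longleftrightarrow> cadjoint X = X"

definition nonneg_hermitian :: "complex ^ 'n ^ 'n \<Rightarrow> bool" where
  "nonneg_hermitian X \<longleftrightarrow> hermitian X \<and> (\<forall>x. 0 \<le> Re (hdot x (X *v x)))"

definition block_mat ::
  "complex ^ 'm ^ 'm \<Rightarrow> complex ^ 'm ^ 'm \<Rightarrow> complex ^ 'm ^ 'm \<Rightarrow> complex ^ 'm ^ 'm \<Rightarrow> 'm::finite cmat2" where
  "block_mat X Y Z V = (\<chi> i j.
     (case (i, j) of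
        (Inl a, Inl b) \<Rightarrow> X $ a $ b
      | (Inl a, Inr b) \<Rightarrow> Y $ a $ b
      | (Inr a, Inl b) \<Rightarrow> Z $ a $ b
      | (Inr a, Inr b) \<Rightarrow> V $ a $ b))"

text \<open>The matrix \<open>(X, Y)\<close> with twice as many columns.\<close>

definition row_join :: "complex ^ 'k ^ 'n \<Rightarrow> complex ^ 'k ^ 'n \<Rightarrow> complex ^ ('k::finite + 'k) ^ 'n" where
  "row_join X Y = (\<chi> i j. (case j of Inl a \<Rightarrow> X $ i $ a | Inr a \<Rightarrow> Y $ i $ a))"

definition Jmat :: "'m::finite cmat2" where
  "Jmat = block_mat 0 (- mat 1) (mat 1) 0"


section \<open>The Hamiltonian system\<close>

definition Rshift :: "'m::finite cseq \<Rightarrow> 'm cseq" where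
  "Rshift y n = (\<chi> i. (case i of Inl j \<Rightarrow> y (n + 1) $ Inl j | Inr j \<Rightarrow> y n $ Inr j))"

definition solution :: "(int \<Rightarrow> 'm::finite cmat2) \<Rightarrow> (int \<Rightarrow> 'm cmat2) \<Rightarrow> complex \<Rightarrow> 'm cseq \<Rightarrow> bool" where
  "solution P W \<mu> y \<longleftrightarrow>
     (\<forall>n. Jmat *v (y (n + 1) - y n) = (P n + mat \<mu> ** W n) *v Rshift y n)"

definition lop :: "(int \<Rightarrow> 'm::finite cmat2) \<Rightarrow> 'm cseq \<Rightarrow> 'm cseq" where
  "lop P y n = Jmat *v (y (n + 1) - y n) - P n *v Rshift y n"

text \<open>\<open>R(y)\<^sup>*(n) W(n) R(y)(n)\<close>, which is real when \<open>W(n)\<close> is Hermitian.\<close>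

definition Wdens :: "(int \<Rightarrow> 'm::finite cmat2) \<Rightarrow> 'm cseq \<Rightarrow> int \<Rightarrow> real" where
  "Wdens W y n = Re (hdot (Rshift y n) (W n *v Rshift y n))"

text \<open>
  The limit circle case at an endpoint (both defect indices of the half-line minimal relation equal
  \<open>2m\<close>) is expressed by the half-line square-summability of all solutions for all nonreal parameters.
\<close>

definition limit_circle_pinf :: "(int \<Rightarrow> 'm::finite cmat2) \<Rightarrow> (int \<Rightarrow> 'm cmat2) \<Rightarrow> bool" where
  "limit_circle_pinf P W \<longleftrightarrow>
     (\<forall>\<mu>. \<mu> \<notin> \<real> \<longrightarrow> (\<forall>y. solution P W \<mu> y \<longrightarrow> Wdens W y summable_on {1..}))"

definition limit_circle_minf :: "(int \<Rightarrow> 'm::finite cmat2) \<Rightarrow> (int \<Rightarrow> 'm cmat2) \<Rightarrow> bool" where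
  "limit_circle_minf P W \<longleftrightarrow>
     (\<forall>\<mu>. \<mu> \<notin> \<real> \<longrightarrow> (\<forall>y. solution P W \<mu> y \<longrightarrow> Wdens W y summable_on {..0}))"


section \<open>The space of square-summable sequences\<close>

definition l2hat :: "(int \<Rightarrow> 'm::finite cmat2) \<Rightarrow> 'm cseq set" where
  "l2hat W = {y. Wdens W y summable_on UNIV}"

definition dinner :: "(int \<Rightarrow> 'm::finite cmat2) \<Rightarrow> 'm cseq \<Rightarrow> 'm cseq \<Rightarrow> complex" where
  "dinner W y z = (\<Sum>\<^sub>\<infinity>n\<in>UNIV. hdot (Rshift z n) (W n *v Rshift y n))"

definition dnorm :: "(int \<Rightarrow> 'm::finite cmat2) \<Rightarrow> 'm cseq \<Rightarrow> real" where
  "dnorm W y = sqrt (Re (dinner W y y))"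

definition l2class :: "(int \<Rightarrow> 'm::finite cmat2) \<Rightarrow> 'm cseq \<Rightarrow> 'm cseq set" where
  "l2class W y = {z \<in> l2hat W. dnorm W (\<lambda>n. z n - y n) = 0}"

definition complex_field :: "complex ring" where
  "complex_field = \<lparr>carrier = UNIV, mult = (*), one = 1, zero = 0, add = (+)\<rparr>"

text \<open>
  The quotient of \<^const>\<open>l2hat\<close> by the sequences of seminorm zero, as a vector space over
  \<^const>\<open>complex_field\<close>.  Addition and scaling are defined through representatives; the union
  is over equal sets.  The ring components of the record are irrelevant for a module.
\<close>

definition l2W :: "(int \<Rightarrow> 'm::finite cmat2) \<Rightarrow> (complex, 'm cseq set) module" where
  "l2W W =
     \<lparr>carrier = l2class W ` l2hat W,
      mult = undefined, one = undefined,
      zero = l2class W (\<lambda>n. 0),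
      add = (\<lambda>Y Z. \<Union>y\<in>Y. \<Union>z\<in>Z. l2class W (\<lambda>n. y n + z n)),
      smult = (\<lambda>c Y. \<Union>y\<in>Y. l2class W (\<lambda>n. c *s y n))\<rparr>"


section \<open>Linear relations\<close>

definition rel_shift :: "('a, 'b, 'c) module_scheme \<Rightarrow> ('b \<times> 'b) set \<Rightarrow> 'a \<Rightarrow> ('b \<times> 'b) set" where
  "rel_shift V T \<mu> = {(f, g \<ominus>\<^bsub>V\<^esub> (\<mu> \<odot>\<^bsub>V\<^esub> f)) | f g. (f, g) \<in> T}"

definition rel_null :: "('a, 'b, 'c) module_scheme \<Rightarrow> ('b \<times> 'b) set \<Rightarrow> 'b set" where
  "rel_null V T = {f. (f, \<zero>\<^bsub>V\<^esub>) \<in> T}"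

definition rel_eigenvalue :: "('a, 'b, 'c) module_scheme \<Rightarrow> ('b \<times> 'b) set \<Rightarrow> 'a \<Rightarrow> bool" where
  "rel_eigenvalue V T \<mu> \<longleftrightarrow> rel_null V (rel_shift V T \<mu>) \<noteq> {\<zero>\<^bsub>V\<^esub>}"

definition eigenspace :: "('a, 'b, 'c) module_scheme \<Rightarrow> ('b \<times> 'b) set \<Rightarrow> 'a \<Rightarrow> ('a, 'b, 'c) module_scheme" where
  "eigenspace V T \<mu> = V\<lparr>carrier := rel_null V (rel_shift V T \<mu>)\<rparr>"


section \<open>The maximal relation and its restriction by boundary conditions\<close>

definition max_rep ::
  "(int \<Rightarrow> 'm::finite cmat2) \<Rightarrow> (int \<Rightarrow> 'm cmat2) \<Rightarrow> 'm cseq set \<Rightarrow> 'm cseq set \<Rightarrow> 'm cseq \<Rightarrow> bool" where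
  "max_rep P W Y G y \<longleftrightarrow>
     y \<in> Y \<and> (\<forall>g\<in>G. \<forall>n. lop P y n = W n *v Rshift g n)"

definition max_rel ::
  "(int \<Rightarrow> 'm::finite cmat2) \<Rightarrow> (int \<Rightarrow> 'm cmat2) \<Rightarrow> ('m cseq set \<times> 'm cseq set) set" where
  "max_rel P W =
     {(Y, G). Y \<in> carrier (l2W W) \<and> G \<in> carrier (l2W W) \<and> (\<exists>y. max_rep P W Y G y)}"

text \<open>
  The representative with which the first component of a pair in \<^const>\<open>max_rel\<close> is identified.
  It belongs to the pair: it is unique for given \<open>(Y, G)\<close>, but when \<^const>\<open>max_rel\<close> is
  multivalued it may depend on \<open>G\<close> as well as on \<open>Y\<close>.
\<close>

definition the_rep ::
  "(int \<Rightarrow> 'm::finite cmat2) \<Rightarrow> (int \<Rightarrow> 'm cmat2) \<Rightarrow> 'm cseq set \<Rightarrow> 'm cseq set \<Rightarrow> 'm cseq" where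
  "the_rep P W Y G = (THE y. max_rep P W Y G y)"

definition dform :: "'m::finite cseq \<Rightarrow> 'm cseq \<Rightarrow> int \<Rightarrow> complex" where
  "dform x y n = hdot (y n) (Jmat *v x n)"

text \<open>The filter \<^term>\<open>F\<close> is \<^term>\<open>at_bot\<close> for \<open>-\<infinity>\<close> and \<^term>\<open>at_top\<close> for \<open>+\<infinity>\<close>.\<close>

definition dform_lim :: "int filter \<Rightarrow> 'm::finite cseq \<Rightarrow> 'm cseq \<Rightarrow> complex" where
  "dform_lim F x y = Lim F (dform x y)"

definition fund_sol ::
  "(int \<Rightarrow> 'm::finite cmat2) \<Rightarrow> (int \<Rightarrow> 'm cmat2) \<Rightarrow> complex \<Rightarrow> 'm + 'm \<Rightarrow> 'm cseq" where
  "fund_sol P W \<mu> i = (THE y. solution P W \<mu> y \<and> y 0 = axis i 1)"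

definition boundary_vec ::
  "(int \<Rightarrow> 'm::finite cmat2) \<Rightarrow> (int \<Rightarrow> 'm cmat2) \<Rightarrow> int filter \<Rightarrow> 'm cseq \<Rightarrow> 'm cvec2" where
  "boundary_vec P W F y = (\<chi> j. dform_lim F y (fund_sol P W 0 j))"

definition Theta_lim ::
  "(int \<Rightarrow> 'm::finite cmat2) \<Rightarrow> (int \<Rightarrow> 'm cmat2) \<Rightarrow> int filter \<Rightarrow> complex \<Rightarrow> 'm cmat2" where
  "Theta_lim P W F \<mu> = (\<chi> j i. dform_lim F (fund_sol P W \<mu> i) (fund_sol P W 0 j))"

definition T_D ::
  "(int \<Rightarrow> 'm::finite cmat2) \<Rightarrow> (int \<Rightarrow> 'm cmat2) \<Rightarrow> 'm cmat2 \<Rightarrow> 'm cmat2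
     \<Rightarrow> ('m cseq set \<times> 'm cseq set) set" where
  "T_D P W M N =
     {(Y, G) \<in> max_rel P W.
        M *v boundary_vec P W at_bot (the_rep P W Y G)
        - N *v boundary_vec P W at_top (the_rep P W Y G) = 0}"

definition Gamma_d ::
  "(int \<Rightarrow> 'm::finite cmat2) \<Rightarrow> (int \<Rightarrow> 'm cmat2) \<Rightarrow> 'm cmat2 \<Rightarrow> 'm cmat2 \<Rightarrow> complex \<Rightarrow> complex" where
  "Gamma_d P W M N \<mu> = det (M ** Theta_lim P W at_bot \<mu> - N ** Theta_lim P W at_top \<mu>)"

end

theory Submission
  imports Defs
begin

text \<open>
  Let \<open>Y\<^sub>\<lambda>\<close> be the fundamental matrix with \<open>Y\<^sub>\<lambda>(0) = I\<close> and \<open>X\<^sub>\<kappa>\<^sub>\<lambda> = Y\<^sub>\<kappa>\<^sup>* J Y\<^sub>\<lambda>\<close>, so that \<open>\<Theta>\<^sub>\<lambda> = X\<^sub>0\<^sub>\<lambda>\<close>.  The transfer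
  matrices and their inverses are quadratic in \<open>\<lambda>\<close>, hence so is \<open>X\<^sub>\<kappa>\<^sub>\<lambda>(n+1) X\<^sub>\<kappa>\<^sub>\<lambda>(n)\<^sup>-\<^sup>1 - I\<close>.  In the limit circle
  case this is summable over \<open>n\<close> for nonreal \<open>\<kappa>, \<lambda>\<close>; interpolating at three nonreal nodes makes it summable
  locally uniformly in \<open>\<lambda>\<close>, first for nonreal \<open>\<kappa>\<close> and then for \<open>\<kappa> = 0\<close>.  So \<open>\<Theta>\<^sub>\<lambda>(\<plusminus>\<infinity>)\<close> exists and is entire.

  Put \<open>D(\<lambda>) = M \<Theta>\<^sub>\<lambda>(-\<infinity>) - N \<Theta>\<^sub>\<lambda>(+\<infinity>)\<close>.  The space \<open>{(a, b). M a = N b}\<close> is isotropic for \<open>a\<^sup>* J a' - b\<^sup>* J b'\<close>.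
  With the Lagrange identity this forces \<open>\<lambda>\<close> to be real if \<open>D(\<lambda>)\<close> is singular, and the Lagrange identity
  differentiated in \<open>\<lambda>\<close> shows that \<open>D(\<lambda>) c\<^sub>0 = 0\<close> and \<open>D'(\<lambda>) c\<^sub>0 + D(\<lambda>) c\<^sub>1 = 0\<close> make the norm of the solution
  \<open>Y\<^sub>\<lambda> c\<^sub>0\<close> vanish.  Thus \<open>D\<close> has no Jordan chain of length two, and the order of the zero of \<open>det D\<close> is the
  dimension of \<open>ker D(\<lambda>)\<close>, which \<open>c \<mapsto> Y\<^sub>\<lambda> c\<close> identifies with the eigenspace.
\<close>

no_notation fps_nth (infixl \<open>$\<close> 75)

section \<open>Adjoints, block matrices and the boundary space\<close>

lemma cadjoint_nth [simp]: "cadjoint X $ i $ j = cnj (X $ j $ i)"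
  by (simp add: cadjoint_def)

lemma cadjoint_cadjoint [simp]: "cadjoint (cadjoint X) = X"
  by (simp add: vec_eq_iff)

lemma cadjoint_mult: "cadjoint (X ** Y) = cadjoint Y ** cadjoint X"
  by (simp add: vec_eq_iff matrix_matrix_mult_def mult.commute)

lemma cadjoint_mat_1 [simp]: "cadjoint (mat 1) = mat 1"
  by (auto simp: vec_eq_iff mat_def)

lemma cadjoint_diff: "cadjoint (X - Y) = cadjoint X - cadjoint Y"
  by (simp add: vec_eq_iff)

lemma cadjoint_add: "cadjoint (X + Y) = cadjoint X + cadjoint Y"
  by (simp add: vec_eq_iff)

lemma cadjoint_minus: "cadjoint (- X) = - cadjoint X"
  by (simp add: vec_eq_iff)

lemma hdot_add_right: "hdot x (y + z) = hdot x y + hdot x z"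
  by (simp add: hdot_def algebra_simps sum.distrib)

lemma hdot_add_left: "hdot (x + y) z = hdot x z + hdot y z"
  by (simp add: hdot_def algebra_simps sum.distrib)

lemma hdot_scale_right: "hdot x (c *s y) = c * hdot x y"
  by (simp add: hdot_def sum_distrib_left algebra_simps)

lemma hdot_scale_left: "hdot (c *s x) y = cnj c * hdot x y"
  by (simp add: hdot_def sum_distrib_left algebra_simps)

lemma hdot_0_right [simp]: "hdot x 0 = 0"
  by (simp add: hdot_def)

lemma cnj_hdot: "cnj (hdot x y) = hdot y x"
  by (simp add: hdot_def algebra_simps)

lemma hdot_axis_left: "hdot (axis i 1) y = y $ i"
  by (simp add: hdot_def axis_def if_distrib [of cnj] if_distrib [of "\<lambda>z. z * _"] cong: if_cong)

lemma hdot_matrix_right: "hdot x (X *v y) = hdot (cadjoint X *v x) y"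
  unfolding hdot_def matrix_vector_mult_def
  by (simp add: sum_distrib_left sum_distrib_right algebra_simps) (rule sum.swap)

lemma hdot_matrix_left: "hdot (X *v x) y = hdot x (cadjoint X *v y)"
  by (simp add: hdot_matrix_right)

lemma matrix_mul_diff_left: "(X - Y) ** Z = X ** Z - Y ** (Z :: 'a::ring_1 ^ 'n ^ 'm)"
  by (simp add: vec_eq_iff matrix_matrix_mult_def left_diff_distrib sum_subtractf)

lemma matrix_mul_diff_right: "Z ** (X - Y) = Z ** X - Z ** (Y :: 'a::ring_1 ^ 'n ^ 'm)"
  by (simp add: vec_eq_iff matrix_matrix_mult_def right_diff_distrib sum_subtractf)

lemma matrix_mul_minus_left: "(- X) ** Z = - (X ** (Z :: 'a::ring_1 ^ 'n ^ 'm))"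
  by (simp add: vec_eq_iff matrix_matrix_mult_def sum_negf)

lemma matrix_mul_minus_right: "Z ** (- X) = - (Z ** (X :: 'a::ring_1 ^ 'n ^ 'm))"
  by (simp add: vec_eq_iff matrix_matrix_mult_def sum_negf)

lemma matrix_vector_minus_left: "(- X) *v x = - (X *v (x :: 'a::ring_1 ^ 'n))"
  by (simp add: vec_eq_iff matrix_vector_mult_def sum_negf)

lemma matrix_vector_minus_right: "X *v (- x) = - (X *v (x :: 'a::ring_1 ^ 'n))"
  by (simp add: vec_eq_iff matrix_vector_mult_def sum_negf)

lemma matrix_vector_scale_right: "X *v (c *s x) = c *s (X *v (x :: 'a::comm_ring_1 ^ 'n))"
  by (simp add: vec_eq_iff matrix_vector_mult_def sum_distrib_left algebra_simps)

lemma mat_matrix_vector: "(mat c ** X) *v x = c *s (X *v (x :: 'a::comm_ring_1 ^ 'n))"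
  by (simp add: vec_eq_iff matrix_vector_mult_def matrix_matrix_mult_def mat_def
      sum_distrib_left if_distrib [of "\<lambda>z. z * _"] if_distrib [of "\<lambda>z. _ * z"] mult.assoc cong: if_cong)

section \<open>Block matrices and the symplectic unit J\<close>

lemma sum_UNIV_Plus:
  fixes f :: "'a::finite + 'b::finite \<Rightarrow> 'c::comm_monoid_add"
  shows "(\<Sum>i\<in>UNIV. f i) = (\<Sum>a\<in>UNIV. f (Inl a)) + (\<Sum>b\<in>UNIV. f (Inr b))"
  by (subst UNIV_Plus_UNIV [symmetric], subst sum.Plus) simp_all

lemma block_mat_nth [simp]:
  "block_mat X Y Z V $ Inl a $ Inl b = X $ a $ b"
  "block_mat X Y Z V $ Inl a $ Inr b = Y $ a $ b"
  "block_mat X Y Z V $ Inr a $ Inl b = Z $ a $ b"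
  "block_mat X Y Z V $ Inr a $ Inr b = V $ a $ b"
  by (simp_all add: block_mat_def)

lemma block_mat_mult:
  "block_mat X Y Z V ** block_mat X' Y' Z' V' =
     block_mat (X ** X' + Y ** Z') (X ** Y' + Y ** V') (Z ** X' + V ** Z') (Z ** Y' + V ** V')"
proof (simp only: vec_eq_iff, intro allI)
  fix i j
  show "(block_mat X Y Z V ** block_mat X' Y' Z' V') $ i $ j =
      block_mat (X ** X' + Y ** Z') (X ** Y' + Y ** V') (Z ** X' + V ** Z') (Z ** Y' + V ** V') $ i $ j"
    by (cases i; cases j) (simp_all add: matrix_matrix_mult_def sum_UNIV_Plus)
qed

lemma block_mat_1: "block_mat (mat 1) 0 0 (mat 1) = (mat 1 :: 'm::finite cmat2)"
proof (simp only: vec_eq_iff, intro allI)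
  fix i j :: "'m + 'm"
  show "block_mat (mat 1) 0 0 (mat 1) $ i $ j = mat 1 $ i $ j"
    by (cases i; cases j) (simp_all add: mat_def)
qed

lemma cadjoint_block_mat:
  "cadjoint (block_mat X Y Z V) = block_mat (cadjoint X) (cadjoint Z) (cadjoint Y) (cadjoint V)"
proof (simp only: vec_eq_iff, intro allI)
  fix i j
  show "cadjoint (block_mat X Y Z V) $ i $ j =
      block_mat (cadjoint X) (cadjoint Z) (cadjoint Y) (cadjoint V) $ i $ j"
    by (cases i; cases j) simp_all
qed

lemma Jmat_Jmat: "Jmat ** Jmat = - mat 1"
proof -
  have "Jmat ** Jmat = block_mat (- mat 1) 0 0 (- mat 1 :: complex^'a^'a)"
    by (simp add: Jmat_def block_mat_mult matrix_mul_minus_left matrix_mul_minus_right)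
  also have "\<dots> = - block_mat (mat 1) 0 0 (mat 1)"
    by (simp add: vec_eq_iff block_mat_def split: sum.split)
  finally show ?thesis by (simp add: block_mat_1)
qed

lemma cadjoint_Jmat: "cadjoint Jmat = - Jmat"
proof -
  have "cadjoint Jmat = block_mat 0 (mat 1) (- mat 1) (0 :: complex^'a^'a)"
    unfolding Jmat_def cadjoint_block_mat
    by (simp add: cadjoint_minus) (simp add: vec_eq_iff block_mat_def split: sum.split)
  also have "\<dots> = - Jmat"
    by (simp add: Jmat_def vec_eq_iff block_mat_def split: sum.split)
  finally show ?thesis .
qed

section \<open>Rank, kernels and ranges of rectangular matrices\<close>

text \<open>The set \<open>rows H\<close> merges equal rows, so distinctness must come first: the
  rank bounds its cardinality from below by the number of indices. The rows then form an independent
  family, which is equivalent to right invertibility.\<close>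

lemma full_row_rank_right_inverse:
  fixes H :: "'a::field ^ 'n ^ 'm"
  assumes "rank H = CARD('m)"
  obtains R :: "'a ^ 'm ^ 'n" where "H ** R = mat 1"
proof -
  have rows: "rows H = range (\<lambda>i. row i H)"
    by (auto simp: rows_def)
  have card_le: "card (rows H) \<le> CARD('m)"
    unfolding rows by (rule card_image_le) simp
  moreover have "vec.dim (rows H) \<le> card (rows H)"
    by (rule vec.dim_le_card') (simp add: rows)
  ultimately have card: "card (rows H) = CARD('m)"
    using assms by (simp add: row_rank_def_gen)
  then have inj: "inj (\<lambda>i. row i H)"
    unfolding rows by (metis eq_card_imp_inj_on finite)
  then have inv_row: "inv_into UNIV (\<lambda>i. row i H) (row i H) = i" for i
    using inv_into_f_f [of "\<lambda>i. row i H" UNIV i] by simp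
  have indep: "vec.independent (rows H)"
    by (rule vec.card_le_dim_spanning [OF order_refl]) 
      (use assms card in \<open>auto simp: row_rank_def_gen rows vec.span_base\<close>)
  have "\<forall>c. (\<Sum>i\<in>UNIV. c i *s row i H) = 0 \<longrightarrow> (\<forall>i. c i = 0)"
  proof (intro allI impI)
    fix c :: "'m \<Rightarrow> 'a" and i
    assume 0: "(\<Sum>i\<in>UNIV. c i *s row i H) = 0"
    have "(\<Sum>v\<in>rows H. c (inv_into UNIV (\<lambda>i. row i H) v) *s v) = 0"
      unfolding rows by (subst sum.reindex [OF inj]) (simp add: inv_row 0)
    then have "\<forall>v\<in>rows H. c (inv_into UNIV (\<lambda>i. row i H) v) = 0"
      using indep vec.independentD [of "rows H" "rows H" "\<lambda>v. c (inv_into UNIV (\<lambda>i. row i H) v)"]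
      by (auto simp: rows)
    then show "c i = 0"
      by (auto simp: rows inv_row)
  qed
  then have "\<exists>R :: 'a ^ 'm ^ 'n. H ** R = mat 1"
    by (simp only: matrix_right_invertible_independent_rows)
  then show thesis
    using that by auto
qed

text \<open>Dimension count: the right inverse makes the whole space the direct sum of the kernel of
  \<open>H\<close> and the range of \<open>R\<close>, so the kernel has dimension
  \<open>CARD('k)\<close>. The range of \<open>G\<close> lies in it and has the same dimension
  because \<open>G\<close> is injective.\<close>

lemma kernel_eq_range:
  fixes H :: "'a::field ^ 'n ^ 'm" and G :: "'a ^ 'k ^ 'n"
  assumes H: "H ** R = mat 1" and G: "R' ** G = mat 1" and HG: "H ** G = 0"
    and card: "CARD('m) + CARD('k) = CARD('n)" and x: "H *v x = 0"
  obtains s where "x = G *v s"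
proof -
  let ?K = "{x. H *v x = 0}"
  have inj_R: "inj ((*v) R)"
    by (rule inj_on_inverseI [where g = "(*v) H"]) (simp add: H matrix_vector_mul_assoc)
  have inj_G: "inj ((*v) G)"
    by (rule inj_on_inverseI [where g = "(*v) R'"]) (simp add: G matrix_vector_mul_assoc)
  have dim_R: "vec.dim (range ((*v) R)) = CARD('m)"
    using vec.dim_image_eq [of "(*v) R" UNIV] by (simp add: inj_R vec_dim_card card_cart_basis)
  have dim_G: "vec.dim (range ((*v) G)) = CARD('k)"
    using vec.dim_image_eq [of "(*v) G" UNIV] by (simp add: inj_G vec_dim_card card_cart_basis)
  have sub_K: "vec.subspace ?K"
    by (rule vec.linear_subspace_kernel) simp
  have sub_R: "vec.subspace (range ((*v) R))" and sub_G: "vec.subspace (range ((*v) G))"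
    by (intro vec.linear_subspace_image; simp)+
  have Int: "?K \<inter> range ((*v) R) = {0}"
    by (auto simp: matrix_vector_mul_assoc H intro: image_eqI [of _ _ 0])
  have "\<exists>u v. y = u + v \<and> u \<in> ?K \<and> v \<in> range ((*v) R)" for y
  proof (intro exI conjI)
    show "y = (y - R *v (H *v y)) + R *v (H *v y)"
      by simp
    show "y - R *v (H *v y) \<in> ?K"
      by (simp add: matrix_vector_mult_diff_distrib matrix_vector_mul_assoc matrix_mul_assoc H)
  qed blast
  then have sum: "{u + v | u v. u \<in> ?K \<and> v \<in> range ((*v) R)} = UNIV"
    by blast
  have "vec.dim ?K + CARD('m) = CARD('n)"
    using vec.dim_sums_Int [OF sub_K sub_R] unfolding Int sum dim_R by (simp add: vec_dim_card card_cart_basis)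
  moreover have "range ((*v) G) \<subseteq> ?K"
    by (auto simp: matrix_vector_mul_assoc HG)
  ultimately have "range ((*v) G) = ?K"
    using vec.subspace_dim_equal [OF sub_G sub_K] card dim_G by simp
  then show thesis
    using x that by blast
qed

lemma row_join_nth [simp]:
  "row_join X Y $ i $ Inl a = X $ i $ a" "row_join X Y $ i $ Inr a = Y $ i $ a"
  by (simp_all add: row_join_def)

text \<open>
  The boundary space \<open>M a = N b\<close> is the image of \<open>s \<mapsto> (J M\<^sup>* s, J N\<^sup>* s)\<close>: the image is contained in it
  by \<open>M J M\<^sup>* = N J N\<^sup>*\<close>, and the dimensions agree.
\<close>

lemma boundary_space_isotropic:
  fixes M N J :: "complex ^ 'k ^ 'k"
  assumes rank: "rank (row_join M N) = CARD('k)"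
    and MN: "M ** J ** cadjoint M = N ** J ** cadjoint N"
    and JJ: "J ** J = - mat 1" and J: "cadjoint J = - J"
    and ab: "M *v a = N *v b" and ab': "M *v a' = N *v b'"
  shows "hdot a (J *v a') = hdot b (J *v b')"
proof -
  obtain R where R: "row_join M N ** R = mat 1"
    using full_row_rank_right_inverse [OF rank] by blast
  \<comment> \<open>The two halves of the right inverse; they provide a right inverse of (M, -N) and
    a left inverse of \<open>G\<close>.\<close>
  define R1 R2 :: "complex ^ 'k ^ 'k"
    where "R1 = (\<chi> i. R $ Inl i)" and "R2 = (\<chi> i. R $ Inr i)"
  have R12: "M ** R1 + N ** R2 = mat 1"
    using R by (simp add: R1_def R2_def vec_eq_iff matrix_matrix_mult_def sum_UNIV_Plus)
  define H where "H = row_join M (- N)"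
  define G :: "complex ^ 'k ^ ('k + 'k)" where
    "G = (\<chi> i. case i of Inl i \<Rightarrow> (J ** cadjoint M) $ i | Inr i \<Rightarrow> (J ** cadjoint N) $ i)"
  have "H ** (\<chi> i. case i of Inl i \<Rightarrow> R1 $ i | Inr i \<Rightarrow> - R2 $ i) = M ** R1 + N ** R2"
    by (simp add: H_def vec_eq_iff matrix_matrix_mult_def sum_UNIV_Plus)
  then have HR: "H ** (\<chi> i. case i of Inl i \<Rightarrow> R1 $ i | Inr i \<Rightarrow> - R2 $ i) = mat 1"
    using R12 by simp
  \<comment> \<open>The left inverse of \<open>G\<close> is the adjoint of
    \<open>M R1 + N R2 = I\<close>, with J inserted to absorb \<open>J J = -I\<close>.\<close>
  have "row_join (- cadjoint R1 ** J) (- cadjoint R2 ** J) ** G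
      = (- cadjoint R1 ** J) ** (J ** cadjoint M) + (- cadjoint R2 ** J) ** (J ** cadjoint N)"
    by (simp add: G_def vec_eq_iff matrix_matrix_mult_def [of "row_join _ _"]
        matrix_matrix_mult_def [of "_ ** J"] sum_UNIV_Plus)
  also have "\<dots> = - (cadjoint R1 ** (J ** J) ** cadjoint M + cadjoint R2 ** (J ** J) ** cadjoint N)"
    by (simp add: matrix_mul_assoc matrix_mul_minus_left)
  also have "\<dots> = cadjoint (M ** R1 + N ** R2)"
    by (simp add: JJ cadjoint_mult cadjoint_add matrix_mul_minus_left matrix_mul_minus_right)
  finally have G': "row_join (- cadjoint R1 ** J) (- cadjoint R2 ** J) ** G = mat 1"
    by (simp add: R12)
  have "H ** G = M ** (J ** cadjoint M) - N ** (J ** cadjoint N)"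
    by (simp add: H_def G_def vec_eq_iff matrix_matrix_mult_def [of "row_join _ _"]
        matrix_matrix_mult_def [of M] matrix_matrix_mult_def [of N] sum_UNIV_Plus sum_negf)
  then have HG: "H ** G = 0"
    using MN by (simp add: matrix_mul_assoc)
  have card_sum: "CARD('k + 'k) = CARD('k) + CARD('k)"
    by simp
  have ex: "\<exists>s. a = J *v (cadjoint M *v s) \<and> b = J *v (cadjoint N *v s)"
    if ab: "M *v a = N *v b" for a b
  proof -
    define x :: "complex ^ ('k + 'k)" where "x = (\<chi> i. case i of Inl i \<Rightarrow> a $ i | Inr i \<Rightarrow> b $ i)"
    have "H *v x = M *v a - N *v b"
      by (simp add: H_def x_def vec_eq_iff matrix_vector_mult_def sum_UNIV_Plus sum_negf)
    then have "H *v x = 0"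
      using ab by simp
    then obtain s where s: "x = G *v s"
      using kernel_eq_range [OF HR G' HG card_sum [symmetric]] by blast
    have "a $ i = (J *v (cadjoint M *v s)) $ i" "b $ i = (J *v (cadjoint N *v s)) $ i" for i
      using arg_cong [OF s, of "\<lambda>v. v $ Inl i"] arg_cong [OF s, of "\<lambda>v. v $ Inr i"]
      unfolding matrix_vector_mul_assoc
      by (simp_all add: x_def G_def matrix_vector_mult_def)
    then show ?thesis
      by (auto simp: vec_eq_iff)
  qed
  \<comment> \<open>On the image of \<open>G\<close> the two forms become the matrices of
    \<open>MJM\<close> and its counterpart for \<open>N\<close>, which agree by hypothesis.\<close>
  have pair: "hdot (J *v (cadjoint X *v s)) (J *v (J *v (cadjoint X *v s')))
      = hdot s ((X ** J ** cadjoint X) *v s')" for X :: "complex ^ 'k ^ 'k" and s s'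
  proof -
    have "J *v (J *v z) = - z" for z
      by (simp add: matrix_vector_mul_assoc JJ matrix_vector_minus_left)
    then show ?thesis
      by (simp only: hdot_matrix_left [of J] hdot_matrix_left [of "cadjoint X"] cadjoint_cadjoint J)
        (simp add: matrix_vector_minus_left matrix_vector_minus_right flip: matrix_vector_mul_assoc)
  qed
  from ex [OF ab] ex [OF ab'] obtain s s' where
    "a = J *v (cadjoint M *v s)" "b = J *v (cadjoint N *v s)"
    "a' = J *v (cadjoint M *v s')" "b' = J *v (cadjoint N *v s')"
    by auto
  then show ?thesis
    by (simp only: pair MN)
qed


section \<open>Symplectic recursions in the limit circle case\<close>

text \<open>The entrywise 1-norm is submultiplicative, invariant under the adjoint, and lets scalar
  estimates be summed over entries.\<close>

definition mnorm :: "complex ^ 'n ^ 'm \<Rightarrow> real" where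
  "mnorm X = (\<Sum>i\<in>UNIV. \<Sum>j\<in>UNIV. cmod (X $ i $ j))"

lemma mnorm_nonneg [simp]: "0 \<le> mnorm X"
  by (simp add: mnorm_def sum_nonneg)

lemma norm_entry_le_mnorm: "cmod (X $ i $ j) \<le> mnorm X"
proof -
  have "cmod (X $ i $ j) \<le> (\<Sum>j\<in>UNIV. cmod (X $ i $ j))"
    by (rule member_le_sum) auto
  also have "\<dots> \<le> mnorm X"
    unfolding mnorm_def
    by (rule member_le_sum [where f = "\<lambda>i. \<Sum>j\<in>UNIV. cmod (X $ i $ j)"]) (auto simp: sum_nonneg)
  finally show ?thesis .
qed

lemma mnorm_add: "mnorm (X + Y) \<le> mnorm X + mnorm Y"
  unfolding mnorm_def sum.distrib [symmetric]
  by (intro sum_mono) (simp add: norm_triangle_ineq)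

lemma mnorm_minus [simp]: "mnorm (- X) = mnorm X"
  by (simp add: mnorm_def)

lemma mnorm_cadjoint [simp]: "mnorm (cadjoint X) = mnorm X"
  unfolding mnorm_def by (subst sum.swap) simp

lemma mnorm_mult: "mnorm (X ** Y) \<le> mnorm X * mnorm Y"
proof -
  have "mnorm (X ** Y) \<le> (\<Sum>i\<in>UNIV. \<Sum>j\<in>UNIV. \<Sum>k\<in>UNIV. cmod (X $ i $ k) * cmod (Y $ k $ j))"
    unfolding mnorm_def matrix_matrix_mult_def
    by (intro sum_mono) (simp add: norm_mult sum_norm_le)
  also have "\<dots> = (\<Sum>i\<in>UNIV. \<Sum>k\<in>UNIV. cmod (X $ i $ k) * (\<Sum>j\<in>UNIV. cmod (Y $ k $ j)))"
    unfolding sum_distrib_left by (intro sum.cong sum.swap refl)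
  also have "\<dots> \<le> (\<Sum>i\<in>UNIV. \<Sum>k\<in>UNIV. cmod (X $ i $ k) * mnorm Y)"
    unfolding mnorm_def
    by (intro sum_mono mult_left_mono
        member_le_sum [where f = "\<lambda>k. \<Sum>j\<in>UNIV. cmod (Y $ k $ j)"]) (auto simp: sum_nonneg)
  also have "\<dots> = mnorm X * mnorm Y"
    by (simp add: mnorm_def sum_distrib_right)
  finally show ?thesis .
qed

lemma mnorm_bounded_of_summable_diff:
  assumes "summable (\<lambda>n. mnorm (Z (Suc n) - Z n))"
  obtains B where "\<And>n. mnorm (Z n) \<le> B" "0 \<le> B"
proof -
  have "mnorm (Z n) \<le> mnorm (Z 0) + (\<Sum>k<n. mnorm (Z (Suc k) - Z k))" for n
  proof (induction n)
    case (Suc n)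
    show ?case
      using mnorm_add [of "Z (Suc n) - Z n" "Z n"] Suc by simp
  qed simp
  moreover have "(\<Sum>k<n. mnorm (Z (Suc k) - Z k)) \<le> (\<Sum>k. mnorm (Z (Suc k) - Z k))" for n
    by (rule sum_le_suminf [OF assms]) auto
  ultimately have "mnorm (Z n) \<le> mnorm (Z 0) + (\<Sum>k. mnorm (Z (Suc k) - Z k))" for n
    by (meson add_left_mono order_trans)
  then show thesis
    using that order_trans [OF mnorm_nonneg] by blast
qed

text \<open>Each factor \<open>1 + q n\<close> is at most \<open>exp (q n)\<close>, so the product
  of all factors is controlled by the sum of the series.\<close>

lemma discrete_gronwall:
  fixes a q :: "nat \<Rightarrow> real"
  assumes a: "\<And>n. a (Suc n) \<le> (1 + q n) * a n" and a0: "0 \<le> a 0"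
    and q: "\<And>n. 0 \<le> q n" "summable q"
  shows "a n \<le> a 0 * exp (suminf q)"
proof -
  have "a n \<le> a 0 * exp (\<Sum>k<n. q k)"
  proof (induction n)
    case (Suc n)
    have "a (Suc n) \<le> (1 + q n) * (a 0 * exp (\<Sum>k<n. q k))"
      by (rule order_trans [OF a mult_left_mono [OF Suc]]) (simp add: q add_nonneg_nonneg)
    also have "\<dots> \<le> exp (q n) * (a 0 * exp (\<Sum>k<n. q k))"
      by (intro mult_right_mono exp_ge_add_one_self) (simp add: a0)
    finally show ?case
      by (simp add: exp_add mult_ac)
  qed simp
  also have "\<dots> \<le> a 0 * exp (suminf q)"
    by (intro mult_left_mono a0) (simp add: sum_le_suminf q)
  finally show ?thesis .
qed

section \<open>Functions quadratic in the spectral parameter\<close>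

text \<open>Degree at most two: a transfer matrix is a product of two matrices affine in the
  parameter, and three nodes then determine it.\<close>

definition quadratic :: "(complex \<Rightarrow> complex) \<Rightarrow> bool" where
  "quadratic f \<longleftrightarrow> (\<exists>a b c. \<forall>z. f z = a + b * z + c * z\<^sup>2)"

lemma quadratic_add:
  assumes "quadratic f" "quadratic g"
  shows "quadratic (\<lambda>z. f z + g z)"
proof -
  from assms obtain a b c a' b' c'
    where "\<forall>z. f z = a + b * z + c * z\<^sup>2" "\<forall>z. g z = a' + b' * z + c' * z\<^sup>2"
    unfolding quadratic_def by blast
  then have "\<forall>z. f z + g z = (a + a') + (b + b') * z + (c + c') * z\<^sup>2"
    by (simp add: algebra_simps)
  then show ?thesis
    unfolding quadratic_def by blast
qed

lemma quadratic_const: "quadratic (\<lambda>z. c)"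
  unfolding quadratic_def by (intro exI [of _ c] exI [of _ 0]) simp

lemma quadratic_mult_affine: "quadratic (\<lambda>z. (a + b * z) * (a' + b' * z))"
  unfolding quadratic_def
  by (intro exI [of _ "a * a'"] exI [of _ "a * b' + b * a'"] exI [of _ "b * b'"])
    (simp add: algebra_simps power2_eq_square)

lemma quadratic_cmult:
  assumes "quadratic f"
  shows "quadratic (\<lambda>z. k * f z)"
proof -
  from assms obtain a b c where "\<forall>z. f z = a + b * z + c * z\<^sup>2"
    unfolding quadratic_def by blast
  then have "\<forall>z. k * f z = k * a + (k * b) * z + (k * c) * z\<^sup>2"
    by (simp add: algebra_simps)
  then show ?thesis
    unfolding quadratic_def by blast
qed

lemma quadratic_multc: "quadratic f \<Longrightarrow> quadratic (\<lambda>z. f z * k)"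
  using quadratic_cmult [of f k] by (simp add: mult.commute)

lemma quadratic_sum: "(\<And>i. i \<in> A \<Longrightarrow> quadratic (f i)) \<Longrightarrow> quadratic (\<lambda>z. \<Sum>i\<in>A. f i z)"
  by (induction A rule: infinite_finite_induct) (auto simp: quadratic_const intro: quadratic_add)

lemma quadratic_holomorphic:
  assumes "quadratic f"
  shows "f holomorphic_on A"
proof -
  from assms obtain a b c where "f = (\<lambda>z. a + b * z + c * z\<^sup>2)"
    unfolding quadratic_def by blast
  then show ?thesis
    by (auto intro!: holomorphic_intros)
qed

text \<open>
  Lagrange interpolation; the nodes are nonreal since only nonreal parameters are covered by the
  limit circle hypothesis.
\<close>

lemma quadratic_bound:
  assumes "quadratic f" and z: "cmod z \<le> r"
  shows "cmod (f z) \<le> (r + 3)\<^sup>2 * (cmod (f \<i>) + cmod (f (2 * \<i>)) + cmod (f (3 * \<i>)))"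
proof -
  obtain a b c where f: "f w = a + b * w + c * w\<^sup>2" for w
    using assms unfolding quadratic_def by blast
  \<comment> \<open>Lagrange's formula at the nodes s, 2s, 3s with denominators cleared; the factor
    \<open>-2 s^2\<close> becomes 2 at \<open>s = \<i>\<close>. The nodes have modulus at most 3,
    whence the bound \<open>r + 3\<close> for each linear factor.\<close>
  have "- 2 * s\<^sup>2 * (a + b * z + c * z\<^sup>2) = - (a + b * s + c * s\<^sup>2) * ((z - 2 * s) * (z - 3 * s))
      + 2 * (a + b * (2 * s) + c * (2 * s)\<^sup>2) * ((z - s) * (z - 3 * s))
      - (a + b * (3 * s) + c * (3 * s)\<^sup>2) * ((z - s) * (z - 2 * s))" for s
    by (simp add: algebra_simps power2_eq_square)
  from this [of \<i>]
  have eq: "2 * f z = - f \<i> * ((z - 2 * \<i>) * (z - 3 * \<i>)) + 2 * f (2 * \<i>) * ((z - \<i>) * (z - 3 * \<i>))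
      - f (3 * \<i>) * ((z - \<i>) * (z - 2 * \<i>))"
    unfolding f by simp
  have prod: "cmod ((z - s) * (z - t)) \<le> (r + 3)\<^sup>2" if "cmod s \<le> 3" "cmod t \<le> 3" for s t
  proof -
    have "cmod (z - s) \<le> r + 3" "cmod (z - t) \<le> r + 3"
      using norm_triangle_ineq4 [of z s] norm_triangle_ineq4 [of z t] z that by linarith+
    then show ?thesis
      unfolding norm_mult power2_eq_square by (intro mult_mono) (auto intro: order_trans [OF norm_ge_zero])
  qed
  have "2 * cmod (f z) = cmod (2 * f z)"
    by (simp add: norm_mult)
  also have "\<dots> \<le> cmod (f \<i>) * cmod ((z - 2 * \<i>) * (z - 3 * \<i>))
      + 2 * cmod (f (2 * \<i>)) * cmod ((z - \<i>) * (z - 3 * \<i>))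
      + cmod (f (3 * \<i>)) * cmod ((z - \<i>) * (z - 2 * \<i>))"
    unfolding eq
    by (rule order_trans [OF norm_triangle_ineq4 add_mono [OF order_trans [OF norm_triangle_ineq add_mono]]])
      (simp_all add: norm_mult)
  also have "\<dots> \<le> cmod (f \<i>) * (r + 3)\<^sup>2 + 2 * cmod (f (2 * \<i>)) * (r + 3)\<^sup>2 + cmod (f (3 * \<i>)) * (r + 3)\<^sup>2"
    by (intro add_mono mult_left_mono prod) (auto simp: norm_mult)
  also have "\<dots> \<le> 2 * ((r + 3)\<^sup>2 * (cmod (f \<i>) + cmod (f (2 * \<i>)) + cmod (f (3 * \<i>))))"
    by (simp add: algebra_simps)
  finally show ?thesis
    by simp
qed

lemma tendsto_hdot:
  assumes "(f \<longlongrightarrow> x) F" "(g \<longlongrightarrow> y) F"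
  shows "((\<lambda>n. hdot (f n) (g n)) \<longlongrightarrow> hdot x y) F"
  unfolding hdot_def by (intro tendsto_intros assms)

lemma tendsto_matrix_vector_mult:
  fixes A :: "'b \<Rightarrow> complex ^ 'n ^ 'm"
  assumes "(A \<longlongrightarrow> X) F" "(v \<longlongrightarrow> x) F"
  shows "((\<lambda>n. A n *v v n) \<longlongrightarrow> X *v x) F"
proof (rule vec_tendstoI)
  fix i
  show "((\<lambda>n. (A n *v v n) $ i) \<longlongrightarrow> (X *v x) $ i) F"
    unfolding matrix_vector_mult_def by (simp, intro tendsto_intros assms)
qed

section \<open>One half line as an abstract recursion\<close>

text \<open>The index counts steps away from 0, so that both half lines are instances: the right one
  with the transfer matrices, the left one with their inverses. The parameter is conjugated in
  \<open>symplectic\<close> because the adjoint conjugates it.\<close>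

locale symplectic_recursion =
  fixes J :: "complex ^ 'k ^ 'k" and Y S :: "complex \<Rightarrow> nat \<Rightarrow> complex ^ 'k ^ 'k"
  assumes JJ: "J ** J = - mat 1" and cadjoint_J: "cadjoint J = - J"
    and Y_0: "Y l 0 = mat 1"
    and Y_Suc: "Y l (Suc n) = S l n ** Y l n"
    and S_quadratic: "quadratic (\<lambda>l. S l n $ i $ j)"
    and symplectic: "cadjoint (Y (cnj l) n) ** J ** Y l n = J"
begin

definition X :: "complex \<Rightarrow> complex \<Rightarrow> nat \<Rightarrow> complex ^ 'k ^ 'k" where
  "X a b n = cadjoint (Y a n) ** J ** Y b n"

text \<open>This is \<open>X a b (Suc n)\<close> times the inverse of \<open>X a b n\<close>,
  arranged so that \<open>b\<close> enters only through \<open>S b n\<close>; hence it is quadratic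
  in \<open>b\<close>.\<close>

definition L :: "complex \<Rightarrow> complex \<Rightarrow> nat \<Rightarrow> complex ^ 'k ^ 'k" where
  "L a b n = cadjoint (Y a (Suc n)) ** J ** S b n ** (Y (cnj a) n ** (- J))"

lemma Y_inverse: "(Y (cnj a) n ** (- J)) ** (cadjoint (Y a n) ** J) = mat 1"
proof -
  have "(cadjoint (Y a n) ** J) ** (Y (cnj a) n ** (- J)) = (cadjoint (Y a n) ** J ** Y (cnj a) n) ** (- J)"
    by (simp add: matrix_mul_assoc)
  also have "\<dots> = mat 1"
    using symplectic [of "cnj a" n] by (simp add: matrix_mul_minus_right JJ)
  finally show ?thesis
    using matrix_left_right_inverse by blast
qed

lemma X_0 [simp]: "X a b 0 = J"
  by (simp add: X_def Y_0)

lemma X_Suc: "X a b (Suc n) = L a b n ** X a b n"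
proof -
  have "L a b n ** X a b n = cadjoint (Y a (Suc n)) ** J ** S b n
      ** ((Y (cnj a) n ** (- J)) ** (cadjoint (Y a n) ** J)) ** Y b n"
    by (simp add: L_def X_def matrix_mul_assoc)
  also have "\<dots> = X a b (Suc n)"
    unfolding Y_inverse by (simp add: X_def Y_Suc matrix_mul_assoc)
  finally show ?thesis ..
qed

lemma Y_J_cadjoint_Y: "Y b n ** J ** (cadjoint (Y (cnj b) n) ** J) = - mat 1"
  using Y_inverse [of "cnj b" n]
  by (simp add: matrix_mul_minus_left matrix_mul_minus_right minus_equation_iff [of _ "mat 1"])

text \<open>Up to factors J the inverse is again a matrix of the family \<open>X\<close>, at
  conjugated and exchanged parameters. A bound on the inverse thus follows from summable increments
  of \<open>X\<close>.\<close>

lemma X_inverse: "X a b n ** (J ** X (cnj b) (cnj a) n ** J) = mat 1"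
proof -
  have "X a b n ** (J ** X (cnj b) (cnj a) n ** J)
      = cadjoint (Y a n) ** J ** (Y b n ** J ** (cadjoint (Y (cnj b) n) ** J)) ** Y (cnj a) n ** J"
    by (simp add: X_def matrix_mul_assoc)
  also have "\<dots> = - (cadjoint (Y a n) ** J ** Y (cnj a) n ** J)"
    unfolding Y_J_cadjoint_Y by (simp add: matrix_mul_minus_left matrix_mul_minus_right)
  also have "\<dots> = mat 1"
    using symplectic [of "cnj a" n] by (simp add: JJ)
  finally show ?thesis .
qed

lemma cadjoint_X: "cadjoint (X a b n) = - X b a n"
  by (simp add: X_def cadjoint_mult cadjoint_J matrix_mul_assoc matrix_mul_minus_left matrix_mul_minus_right)

text \<open>The inner product of the three middle factors is \<open>-I\<close>, so pairings of
  solutions at arbitrary parameters reduce to the matrices \<open>X 0 a\<close> and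
  \<open>X 0 b\<close>. Their limits at infinity therefore determine the limits of all such
  pairings.\<close>

lemma X_factor: "cadjoint (X 0 a n) ** J ** X 0 b n = X a b n"
proof -
  have "cadjoint (X 0 a n) ** J ** X 0 b n
      = - (cadjoint (Y a n) ** J ** (Y 0 n ** J ** (cadjoint (Y 0 n) ** J)) ** Y b n)"
    unfolding cadjoint_X by (simp add: X_def matrix_mul_assoc matrix_mul_minus_left)
  also have "\<dots> = X a b n"
    using Y_J_cadjoint_Y [of 0 n]
    by (simp add: X_def matrix_mul_minus_left matrix_mul_minus_right)
  finally show ?thesis .
qed

lemma form_eq: "hdot (Y a n *v u) (J *v (Y b n *v v)) = hdot (X 0 a n *v u) (J *v (X 0 b n *v v))"
proof -
  have "hdot (Y a n *v u) (J *v (Y b n *v v)) = hdot u (X a b n *v v)"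
    by (simp add: hdot_matrix_left X_def matrix_vector_mul_assoc matrix_mul_assoc)
  also have "\<dots> = hdot (X 0 a n *v u) (J *v (X 0 b n *v v))"
    unfolding X_factor [of a n b, symmetric]
    by (simp only: hdot_matrix_left matrix_vector_mul_assoc matrix_mul_assoc)
  finally show ?thesis .
qed

lemma L_quadratic: "quadratic (\<lambda>l. (L a l n - mat 1) $ i $ j)"
proof -
  have "quadratic (\<lambda>l. (U ** S l n ** V) $ i $ j)" for U V :: "complex ^ 'k ^ 'k"
    unfolding matrix_matrix_mult_def vec_lambda_beta
    by (intro quadratic_sum quadratic_cmult quadratic_multc S_quadratic)
  from quadratic_add [OF this quadratic_const [of "- (mat 1 $ i $ j)"]]
  show ?thesis
    by (simp add: L_def)
qed

text \<open>Increments for nonreal \<open>l\<close> control \<open>L - I\<close> at the three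
  interpolation nodes, hence on the whole disc; Gronwall turns this back into a bound on the
  increments. The second assumption serves to bound the inverse of \<open>X a l n\<close>. The
  parameter \<open>a\<close> is left free since the lemma is applied twice.\<close>

lemma X_diff_bound:
  assumes s1: "\<And>l. l \<notin> \<real> \<Longrightarrow> summable (\<lambda>n. mnorm (X a l (Suc n) - X a l n))"
    and s2: "\<And>l. l \<notin> \<real> \<Longrightarrow> summable (\<lambda>n. mnorm (X (cnj l) (cnj a) (Suc n) - X (cnj l) (cnj a) n))"
  shows "\<exists>q. summable q \<and> (\<forall>l n. cmod l \<le> r \<longrightarrow> mnorm (X a l (Suc n) - X a l n) \<le> q n)"
proof -
  \<comment> \<open>\<open>L - I\<close> is the increment of \<open>X\<close> times the inverse of
    \<open>X\<close>, and that inverse is bounded by \<open>X_inverse\<close> and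
    \<open>s2\<close>.\<close>
  have L1: "summable (\<lambda>n. mnorm (L a l n - mat 1))" if l: "l \<notin> \<real>" for l
  proof -
    obtain B where B: "mnorm (X (cnj l) (cnj a) n) \<le> B" "0 \<le> B" for n
      by (rule mnorm_bounded_of_summable_diff [OF s2 [OF l]]) blast
    have "norm (mnorm (L a l n - mat 1)) \<le> mnorm (X a l (Suc n) - X a l n) * (mnorm J * B * mnorm J)" for n
    proof -
      have "L a l n - mat 1 = (L a l n - mat 1) ** (X a l n ** (J ** X (cnj l) (cnj a) n ** J))"
        by (simp add: X_inverse)
      also have "\<dots> = (X a l (Suc n) - X a l n) ** (J ** X (cnj l) (cnj a) n ** J)"
        by (simp add: X_Suc matrix_mul_diff_left matrix_mul_assoc)
      finally have "mnorm (L a l n - mat 1) \<le> mnorm (X a l (Suc n) - X a l n) * mnorm (J ** X (cnj l) (cnj a) n ** J)"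
        using mnorm_mult by metis
      also have "mnorm (J ** X (cnj l) (cnj a) n ** J) \<le> mnorm J * B * mnorm J"
        by (rule order_trans [OF mnorm_mult mult_right_mono [OF order_trans [OF mnorm_mult mult_left_mono]]])
          (simp_all add: B)
      finally show ?thesis
        by (simp add: mult_left_mono)
    qed
    then show ?thesis
      by (rule summable_comparison_test' [OF summable_mult2 [OF s1 [OF l]]])
  qed
  \<comment> \<open>The interpolation bound at the three nodes, independent of \<open>l\<close> on
    the disc.\<close>
  define p where "p n = (r + 3)\<^sup>2 * (mnorm (L a \<i> n - mat 1) + mnorm (L a (2 * \<i>) n - mat 1)
      + mnorm (L a (3 * \<i>) n - mat 1))" for n
  have nonreal: "\<i> \<notin> \<real>" "2 * \<i> \<notin> \<real>" "3 * \<i> \<notin> \<real>"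
    by (simp_all add: complex_is_Real_iff)
  have p: "summable p"
    unfolding p_def by (intro summable_mult summable_add L1 nonreal)
  have p_nonneg: "0 \<le> p n" for n
    by (simp add: p_def)
  have L2: "mnorm (L a l n - mat 1) \<le> p n" if l: "cmod l \<le> r" for l n
  proof -
    have "mnorm (L a l n - mat 1) \<le> (\<Sum>i\<in>UNIV. \<Sum>j\<in>UNIV. (r + 3)\<^sup>2 *
      (cmod ((L a \<i> n - mat 1) $ i $ j) + cmod ((L a (2 * \<i>) n - mat 1) $ i $ j)
        + cmod ((L a (3 * \<i>) n - mat 1) $ i $ j)))"
      unfolding mnorm_def by (intro sum_mono quadratic_bound [OF L_quadratic l])
    also have "\<dots> = p n"
      by (simp only: p_def mnorm_def sum_distrib_left [symmetric] sum.distrib)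
    finally show ?thesis .
  qed
  have diff: "mnorm (X a l (Suc n) - X a l n) \<le> p n * mnorm (X a l n)" if l: "cmod l \<le> r" for l n
  proof -
    have "X a l (Suc n) - X a l n = (L a l n - mat 1) ** X a l n"
      by (simp add: X_Suc matrix_mul_diff_left)
    then have "mnorm (X a l (Suc n) - X a l n) \<le> mnorm (L a l n - mat 1) * mnorm (X a l n)"
      using mnorm_mult by metis
    also have "\<dots> \<le> p n * mnorm (X a l n)"
      by (intro mult_right_mono L2 l) simp
    finally show ?thesis .
  qed
  have bound: "mnorm (X a l n) \<le> mnorm J * exp (suminf p)" if l: "cmod l \<le> r" for l n
  proof -
    have "mnorm (X a l (Suc n)) \<le> (1 + p n) * mnorm (X a l n)" for n
      using mnorm_add [of "X a l (Suc n) - X a l n" "X a l n"] diff [OF l, of n]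
      by (simp add: algebra_simps)
    from discrete_gronwall [of "\<lambda>n. mnorm (X a l n)" p n, OF this]
    show ?thesis
      by (simp add: p p_nonneg)
  qed
  show ?thesis
  proof (intro exI conjI allI impI)
    show "summable (\<lambda>n. p n * (mnorm J * exp (suminf p)))"
      by (rule summable_mult2 [OF p])
    show "mnorm (X a l (Suc n) - X a l n) \<le> p n * (mnorm J * exp (suminf p))" if "cmod l \<le> r" for l n
      using diff [OF that, of n] mult_left_mono [OF bound [OF that, of n] p_nonneg [of n]]
      by linarith
  qed
qed

end

section \<open>Boundary limits, holomorphic in the parameter\<close>

locale limit_circle_recursion = symplectic_recursion J Y S
  for J :: "complex ^ 'k ^ 'k" and Y S :: "complex \<Rightarrow> nat \<Rightarrow> complex ^ 'k ^ 'k" +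
  assumes limit_circle: "a \<notin> \<real> \<Longrightarrow> b \<notin> \<real> \<Longrightarrow> summable (\<lambda>n. mnorm (X a b (Suc n) - X a b n))"
begin

text \<open>First use of the interpolation: for nonreal \<open>a\<close> the second parameter
  becomes arbitrary, in particular 0.\<close>

lemma summable_X_diff_nonreal:
  assumes "a \<notin> \<real>"
  shows "summable (\<lambda>n. mnorm (X a l (Suc n) - X a l n))"
proof -
  have "\<exists>q. summable q \<and> (\<forall>k n. cmod k \<le> cmod l \<longrightarrow> mnorm (X a k (Suc n) - X a k n) \<le> q n)"
  proof (rule X_diff_bound)
    show "summable (\<lambda>n. mnorm (X a k (Suc n) - X a k n))" if "k \<notin> \<real>" for k
      using assms that by (rule limit_circle)
    show "summable (\<lambda>n. mnorm (X (cnj k) (cnj a) (Suc n) - X (cnj k) (cnj a) n))" if "k \<notin> \<real>" for k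
      using assms that by (intro limit_circle) (auto simp: complex_is_Real_iff)
  qed
  then obtain q where q: "summable q" "\<And>n. mnorm (X a l (Suc n) - X a l n) \<le> q n"
    by auto
  show ?thesis
    by (rule summable_comparison_test' [OF q(1)]) (simp add: q(2))
qed

text \<open>Second use of the interpolation, now at \<open>a = 0\<close>. Its premises are about
  \<open>X 0 l\<close> and \<open>X (cnj l) 0\<close> with \<open>l\<close> nonreal; the first is
  the negative adjoint of \<open>X l 0\<close>, so both come from the first use.\<close>

lemma X_0_diff_bound:
  "\<exists>q. summable q \<and> (\<forall>l n. cmod l \<le> r \<longrightarrow> mnorm (X 0 l (Suc n) - X 0 l n) \<le> q n)"
proof (rule X_diff_bound [of 0 r])
  fix l :: complex assume l: "l \<notin> \<real>"
  have "mnorm (X 0 l (Suc n) - X 0 l n) = mnorm (X l 0 (Suc n) - X l 0 n)" for n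
  proof -
    have "cadjoint (X l 0 (Suc n) - X l 0 n) = - (X 0 l (Suc n) - X 0 l n)"
      by (simp add: cadjoint_diff cadjoint_X)
    then show ?thesis
      using mnorm_cadjoint [of "X l 0 (Suc n) - X l 0 n"] by (simp only: mnorm_minus)
  qed
  then show "summable (\<lambda>n. mnorm (X 0 l (Suc n) - X 0 l n))"
    using summable_X_diff_nonreal [OF l] by simp
  show "summable (\<lambda>n. mnorm (X (cnj l) (cnj 0) (Suc n) - X (cnj l) (cnj 0) n))"
    using l by (intro summable_X_diff_nonreal) (auto simp: complex_is_Real_iff)
qed

definition Xlim :: "complex \<Rightarrow> complex ^ 'k ^ 'k" where
  "Xlim l = (\<chi> i j. lim (\<lambda>n. X 0 l n $ i $ j))"

text \<open>The entries are partial sums of a telescoping series dominated by a summable sequence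
  independent of \<open>l\<close>, so the Weierstrass M-test applies.\<close>

lemma X_uniform_limit:
  "uniform_limit (cball 0 r) (\<lambda>n l. X 0 l n $ i $ j) (\<lambda>l. Xlim l $ i $ j) sequentially"
proof -
  obtain q where q: "summable q" "\<And>l n. cmod l \<le> r \<Longrightarrow> mnorm (X 0 l (Suc n) - X 0 l n) \<le> q n"
    using X_0_diff_bound [where r = r] by auto
  define d where "d n l = X 0 l (Suc n) $ i $ j - X 0 l n $ i $ j" for n and l :: complex
  have "uniform_limit (cball 0 r) (\<lambda>n l. \<Sum>k<n. d k l) (\<lambda>l. \<Sum>k. d k l) sequentially"
  proof (rule Weierstrass_m_test [OF _ q(1)])
    fix n and l :: complex
    assume "l \<in> cball 0 r"
    then show "cmod (d n l) \<le> q n"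
      using norm_entry_le_mnorm [of "X 0 l (Suc n) - X 0 l n" i j] q(2) [of l n]
      by (simp add: d_def)
  qed
  from uniform_limit_add [OF uniform_limit_const [where c = "\<lambda>_. J $ i $ j"] this]
  have "uniform_limit (cball 0 r) (\<lambda>n l. J $ i $ j + (\<Sum>k<n. d k l)) (\<lambda>l. J $ i $ j + (\<Sum>k. d k l)) sequentially"
    by simp
  moreover have "J $ i $ j + (\<Sum>k<n. d k l) = X 0 l n $ i $ j" for n l
    unfolding d_def by (subst sum_lessThan_telescope) simp
  ultimately have lim: "uniform_limit (cball 0 r) (\<lambda>n l. X 0 l n $ i $ j) (\<lambda>l. J $ i $ j + (\<Sum>k. d k l)) sequentially"
    by simp
  have eq: "J $ i $ j + (\<Sum>k. d k l) = Xlim l $ i $ j" if "l \<in> cball 0 r" for l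
    using limI [OF tendsto_uniform_limitI [OF lim that]] by (simp add: Xlim_def)
  show ?thesis
    by (rule uniform_limit_cong' [THEN iffD1, OF refl eq lim])
qed

lemma X_tendsto: "(\<lambda>n. X 0 l n) \<longlonglongrightarrow> Xlim l"
proof (intro vec_tendstoI)
  fix i j
  show "(\<lambda>n. X 0 l n $ i $ j) \<longlonglongrightarrow> Xlim l $ i $ j"
    by (rule tendsto_uniform_limitI [OF X_uniform_limit [where r = "cmod l"]]) simp
qed

lemma Y_holomorphic: "(\<lambda>l. Y l n $ i $ j) holomorphic_on A"
proof (induction n arbitrary: i j)
  case (Suc n)
  show ?case
    unfolding Y_Suc matrix_matrix_mult_def
    by (simp, intro holomorphic_on_sum holomorphic_on_mult Suc S_quadratic [THEN quadratic_holomorphic])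
qed (simp add: Y_0)

lemma X_holomorphic: "(\<lambda>l. X 0 l n $ i $ j) holomorphic_on A"
  unfolding X_def matrix_matrix_mult_def by (simp, intro holomorphic_on_sum holomorphic_on_mult holomorphic_on_const Y_holomorphic)

lemma Xlim_holomorphic: "(\<lambda>l. Xlim l $ i $ j) holomorphic_on UNIV"
proof (rule holomorphic_uniform_sequence)
  fix z :: complex
  have "uniform_limit (cball z 1) (\<lambda>n l. X 0 l n $ i $ j) (\<lambda>l. Xlim l $ i $ j) sequentially"
    by (rule uniform_limit_on_subset [OF X_uniform_limit [where r = "cmod z + 1"]])
      (simp add: cball_subset_cball_iff dist_norm)
  then show "\<exists>d>0. cball z d \<subseteq> UNIV \<and>
      uniform_limit (cball z d) (\<lambda>n l. X 0 l n $ i $ j) (\<lambda>l. Xlim l $ i $ j) sequentially"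
    by (intro exI [of _ 1]) simp
qed (auto intro: X_holomorphic)

text \<open>Locally uniform convergence of holomorphic functions carries over to derivatives; this
  permits differentiating the Lagrange identity at infinity.\<close>

lemma X_deriv_tendsto:
  "(\<lambda>n. \<chi> i j. deriv (\<lambda>l. X 0 l n $ i $ j) z) \<longlonglongrightarrow> (\<chi> i j. deriv (\<lambda>l. Xlim l $ i $ j) z)"
proof (intro vec_tendstoI, simp)
  fix i j
  have "uniform_limit (ball 0 (cmod z + 1)) (\<lambda>n l. X 0 l n $ i $ j) (\<lambda>l. Xlim l $ i $ j) sequentially"
    by (rule uniform_limit_on_subset [OF X_uniform_limit ball_subset_cball])
  then show "(\<lambda>n. deriv (\<lambda>l. X 0 l n $ i $ j) z) \<longlonglongrightarrow> deriv (\<lambda>l. Xlim l $ i $ j) z"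
    by (rule deriv_complex_uniform_limit) (auto intro!: always_eventually X_holomorphic)
qed

definition Xlim' :: "complex \<Rightarrow> complex ^ 'k ^ 'k" where
  "Xlim' z = (\<chi> i j. deriv (\<lambda>l. Xlim l $ i $ j) z)"

lemma form_tendsto:
  "(\<lambda>n. hdot (Y a n *v u) (J *v (Y b n *v v))) \<longlonglongrightarrow> hdot (Xlim a *v u) (J *v (Xlim b *v v))"
  unfolding form_eq
  by (intro tendsto_hdot tendsto_matrix_vector_mult tendsto_const X_tendsto)

text \<open>The derivative at \<open>l = z\<close> of the pairing of \<open>Y z n u\<close> with
  \<open>Y l n (u + (l - z) v)\<close>, already rewritten through \<open>X 0\<close> so that its
  limit can be taken. Here \<open>u\<close> and \<open>v\<close> play the parts of the first two
  vectors of a Jordan chain.\<close>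

definition form' :: "complex \<Rightarrow> complex ^ 'k \<Rightarrow> complex ^ 'k \<Rightarrow> nat \<Rightarrow> complex" where
  "form' z u v n = hdot (X 0 z n *v u)
     (J *v ((\<chi> i j. deriv (\<lambda>l. X 0 l n $ i $ j) z) *v u + X 0 z n *v v))"

lemma form_has_derivative:
  "((\<lambda>l. hdot (Y z n *v u) (J *v (Y l n *v (u + (l - z) *s v)))) has_field_derivative form' z u v n) (at z)"
proof -
  have X': "((\<lambda>l. X 0 l n $ i $ j) has_field_derivative deriv (\<lambda>l. X 0 l n $ i $ j) z) (at z)" for i j
    by (rule holomorphic_derivI [OF X_holomorphic open_UNIV UNIV_I])
  have "((\<lambda>l. (X 0 l n *v (u + (l - z) *s v)) $ i) has_field_derivative
      ((\<chi> i j. deriv (\<lambda>l. X 0 l n $ i $ j) z) *v u + X 0 z n *v v) $ i) (at z)" for i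
    unfolding matrix_vector_mult_def
    by (auto intro!: derivative_eq_intros X' simp: sum.distrib mult.commute)
  then have "((\<lambda>l. hdot w (X 0 l n *v (u + (l - z) *s v))) has_field_derivative
      hdot w ((\<chi> i j. deriv (\<lambda>l. X 0 l n $ i $ j) z) *v u + X 0 z n *v v)) (at z)" for w
    unfolding hdot_def by (intro DERIV_sum DERIV_cmult)
  then show ?thesis
    unfolding form_eq unfolding form'_def hdot_matrix_right [of _ J] by blast
qed

lemma form'_tendsto:
  "form' z u v \<longlonglongrightarrow> hdot (Xlim z *v u) (J *v (Xlim' z *v u + Xlim z *v v))"
  unfolding form'_def [abs_def] Xlim'_def
  by (intro tendsto_hdot tendsto_matrix_vector_mult tendsto_add tendsto_const X_tendsto X_deriv_tendsto)

end


section \<open>Order of a determinant at a semisimple zero\<close>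

lemma det_holomorphic:
  assumes "\<And>i j. (\<lambda>z. D z $ i $ j) holomorphic_on A"
  shows "(\<lambda>z. det (D z)) holomorphic_on A"
  unfolding det_def
  by (intro holomorphic_on_sum holomorphic_on_mult holomorphic_on_const holomorphic_on_prod assms)

text \<open>
  Without Jordan chains of length two at \<open>z\<^sub>0\<close>, dividing the columns belonging to a basis of the kernel
  by \<open>z - z\<^sub>0\<close> leaves a matrix that is invertible at \<open>z\<^sub>0\<close>.
\<close>

lemma zorder_det_eq_dim_kernel:
  fixes D :: "complex \<Rightarrow> complex ^ 'k ^ 'k"
  assumes hol: "\<And>i j. (\<lambda>z. D z $ i $ j) holomorphic_on UNIV"
    and no_chain: "\<And>c0 c1. D z0 *v c0 = 0 \<Longrightarrow>
      (\<chi> i j. deriv (\<lambda>z. D z $ i $ j) z0) *v c0 + D z0 *v c1 = 0 \<Longrightarrow> c0 = 0"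
  shows "zorder (\<lambda>z. det (D z)) z0 = int (vec.dim {c. D z0 *v c = 0})"
proof -
  let ?K = "{c. D z0 *v c = 0}"
  define D' where "D' = (\<chi> i j. deriv (\<lambda>z. D z $ i $ j) z0)"
  obtain B where B: "B \<subseteq> ?K" "vec.independent B" "?K \<subseteq> vec.span B" "card B = vec.dim ?K"
    using vec.basis_exists by blast
  define B' where "B' = vec.extend_basis B"
  have B': "B \<subseteq> B'" "vec.independent B'" "vec.span B' = UNIV"
    unfolding B'_def using B(2) by (rule vec.extend_basis_superset vec.independent_extend_basis vec.span_extend_basis)+
  have finB': "finite B'"
    by (rule vec.finiteI_independent [OF B'(2)])
  have "card B' = CARD('k)"
    using vec.dim_eq_card_independent [OF B'(2)] vec.dim_span [of B'] B'(3) by (simp add: vec_dim_card card_cart_basis)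
  then obtain v where v: "bij_betw v (UNIV :: 'k set) B'"
    using finite_same_card_bij [of "UNIV :: 'k set" B'] finB' by auto
  have inj_v: "inj v" and range_v: "range v = B'"
    using v by (auto simp: bij_betw_def)
  \<comment> \<open>The columns of \<open>V\<close> indexed by \<open>I\<close> form the basis of
    the kernel; all entries of \<open>D z V\<close> in these columns vanish at
    \<open>z0\<close>.\<close>
  define I where "I = {i. v i \<in> B}"
  have v_I: "v ` I = B"
    using range_v B'(1) by (auto simp: I_def)
  have card_I: "card I = vec.dim ?K"
    using card_image [OF inj_on_subset [OF inj_v], of I] B(4) v_I by simp
  define V :: "complex ^ 'k ^ 'k" where "V = (\<chi> r i. v i $ r)"
  have V_mult: "V *v x = (\<Sum>i\<in>UNIV. x $ i *s v i)" for x
    by (simp add: V_def vec_eq_iff matrix_vector_mult_def mult.commute)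
  have V_inj: "x = 0" if "V *v x = 0" for x
  proof -
    have "(\<Sum>b\<in>B'. x $ (inv_into UNIV v b) *s b) = (\<Sum>i\<in>UNIV. x $ i *s v i)"
      unfolding range_v [symmetric] by (subst sum.reindex [OF inj_v]) (simp add: inv_into_f_f [OF inj_v])
    then have "(\<Sum>b\<in>B'. x $ (inv_into UNIV v b) *s b) = 0"
      using that by (simp add: V_mult)
    then have "x $ (inv_into UNIV v b) = 0" if "b \<in> B'" for b
      by (rule vec.independentD [OF B'(2) finB' order_refl _ that])
    from this [of "v i" for i] have "x $ i = 0" for i
      using range_v by (auto simp: inv_into_f_f [OF inj_v])
    then show ?thesis
      by (simp add: vec_eq_iff)
  qed
  have det_nz: "det Z \<noteq> 0" if "\<And>x. Z *v x = 0 \<Longrightarrow> x = 0" for Z :: "complex ^ 'k ^ 'k"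
    using that matrix_left_invertible_ker [of Z] by (auto simp: invertible_det_nz [symmetric] invertible_left_inverse)
  have det_V: "det V \<noteq> 0"
    by (rule det_nz [OF V_inj])
  define f where "f r i z = (D z ** V) $ r $ i" for r i z
  have f_hol: "f r i holomorphic_on UNIV" for r i
    unfolding f_def [abs_def] matrix_matrix_mult_def vec_lambda_beta
    by (intro holomorphic_on_sum holomorphic_on_mult holomorphic_on_const hol)
  have f_z0: "f r i z0 = 0" if "i \<in> I" for r i
  proof -
    have "D z0 *v v i = 0"
      using that B(1) by (auto simp: I_def)
    then have "(D z0 *v v i) $ r = 0"
      by simp
    then show ?thesis
      by (simp add: f_def V_def matrix_matrix_mult_def matrix_vector_mult_def)
  qed
  have f_deriv: "deriv (f r i) z0 = (D' ** V) $ r $ i" for r i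
  proof (rule DERIV_imp_deriv)
    have "((\<lambda>z. D z $ r $ k) has_field_derivative deriv (\<lambda>z. D z $ r $ k) z0) (at z0)" for k
      using hol by (intro holomorphic_derivI [where S = UNIV]) auto
    then have "((\<lambda>z. \<Sum>k\<in>UNIV. D z $ r $ k * V $ k $ i) has_field_derivative
        (\<Sum>k\<in>UNIV. deriv (\<lambda>z. D z $ r $ k) z0 * V $ k $ i)) (at z0)"
      by (intro DERIV_sum DERIV_cmult_right)
    then show "(f r i has_field_derivative (D' ** V) $ r $ i) (at z0)"
      by (simp add: f_def [abs_def] D'_def matrix_matrix_mult_def)
  qed
  \<comment> \<open>At \<open>z0\<close> the divided columns receive their derivative, which removes
    the singularity and keeps \<open>E\<close> holomorphic.\<close>
  define E :: "complex \<Rightarrow> complex ^ 'k ^ 'k" where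
    "E z = (\<chi> r i. if i \<in> I then (if z = z0 then deriv (f r i) z0 else (f r i z - f r i z0) / (z - z0))
                   else f r i z)" for z
  have E_hol: "(\<lambda>z. E z $ r $ i) holomorphic_on UNIV" for r i
    using pole_lemma_open [OF f_hol [of r i] open_UNIV, of z0] f_hol [of r i]
    by (cases "i \<in> I") (simp_all add: E_def eta_contract_eq)
  define G :: "complex \<Rightarrow> complex ^ 'k ^ 'k" where
    "G z = (\<chi> i j. if i = j then (if i \<in> I then z - z0 else 1) else 0)" for z
  have EG: "D z ** V = E z ** G z" if "z \<noteq> z0" for z
  proof -
    have "(E z ** G z) $ r $ i = E z $ r $ i * (if i \<in> I then z - z0 else 1)" for r i
      by (simp add: matrix_matrix_mult_def G_def if_distrib [of "\<lambda>y. _ * y"] cong: if_cong)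
    then show ?thesis
      using that by (simp add: vec_eq_iff E_def f_def [symmetric] f_z0)
  qed
  have det_G: "det (G z) = (z - z0) ^ card I" for z
  proof -
    have "det (G z) = (\<Prod>i\<in>UNIV. if i \<in> I then z - z0 else 1)"
      by (subst det_diagonal) (simp_all add: G_def)
    then show ?thesis
      by (simp add: prod.If_cases)
  qed
  have "det (E z0) \<noteq> 0"
  proof (rule det_nz)
    fix x assume x: "E z0 *v x = 0"
    \<comment> \<open>Splitting \<open>x\<close> along \<open>I\<close> turns
      \<open>E z0 x = 0\<close> into the chain equation for \<open>V p\<close> and
      \<open>V q\<close>, with \<open>V p\<close> in the kernel.\<close>
    define p q :: "complex ^ 'k" where
      "p = (\<chi> i. if i \<in> I then x $ i else 0)" and "q = (\<chi> i. if i \<in> I then 0 else x $ i)"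
    have E_z0: "E z0 $ r $ i = (if i \<in> I then (D' ** V) $ r $ i else (D z0 ** V) $ r $ i)" for r i
      by (simp add: E_def f_deriv) (simp add: f_def)
    have "(E z0 *v x) $ r = ((D' ** V) *v p + (D z0 ** V) *v q) $ r" for r
      by (simp add: matrix_vector_mult_def E_z0 p_def q_def flip: sum.distrib) (auto intro!: sum.cong)
    then have "E z0 *v x = D' *v (V *v p) + D z0 *v (V *v q)"
      by (simp add: vec_eq_iff matrix_vector_mul_assoc)
    then have chain: "D' *v (V *v p) + D z0 *v (V *v q) = 0"
      using x by simp
    have "D z0 *v (V *v p) = 0"
      unfolding matrix_vector_mul_assoc
      by (auto simp: vec_eq_iff matrix_vector_mult_def [of "_ ** _"] p_def f_z0 simp flip: f_def
          intro!: sum.neutral)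
    then have "V *v p = 0"
      using no_chain chain by (simp add: D'_def)
    then have p0: "p = 0"
      by (rule V_inj)
    then have "V *v q \<in> ?K"
      using chain by simp
    then have "V *v q \<in> vec.span B"
      using B(3) by blast
    moreover have "finite B"
      using B'(1) finB' by (rule finite_subset)
    ultimately obtain u where u: "V *v q = (\<Sum>b\<in>B. u b *s b)"
      by (auto simp: vec.span_finite)
    \<comment> \<open>The coordinates of the kernel vector \<open>V q\<close> in the kernel basis
      live on \<open>I\<close>, whereas \<open>q\<close> vanishes on \<open>I\<close>; equality of
      the two forces \<open>q = 0\<close>.\<close>
    define w :: "complex ^ 'k" where "w = (\<chi> i. if i \<in> I then u (v i) else 0)"
    have "(\<Sum>b\<in>B. u b *s b) = (\<Sum>i\<in>I. u (v i) *s v i)"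
      unfolding v_I [symmetric] by (subst sum.reindex [OF inj_on_subset [OF inj_v]]) auto
    also have "\<dots> = V *v w"
      unfolding V_mult w_def by (rule sum.mono_neutral_cong_left) auto
    finally have "V *v (q - w) = 0"
      using u by (simp add: matrix_vector_mult_diff_distrib)
    then have "q - w = 0"
      by (rule V_inj)
    then have "q = 0"
      by (auto simp: vec_eq_iff q_def w_def split: if_splits)
    then show "x = 0"
      using p0 by (auto simp: vec_eq_iff p_def q_def split: if_splits)
  qed
  show ?thesis
  proof (rule zorder_eqI [where g = "\<lambda>z. det (E z) / det V" and S = UNIV])
    show "(\<lambda>z. det (E z) / det V) holomorphic_on UNIV"
      using det_V by (intro holomorphic_on_divide holomorphic_on_const det_holomorphic E_hol)
    show "det (E z0) / det V \<noteq> 0"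
      using \<open>det (E z0) \<noteq> 0\<close> det_V by simp
    fix w assume "w \<noteq> z0"
    then have "det (D w) * det V = det (E w) * (w - z0) ^ card I"
      using EG det_G by (metis det_mul)
    then show "det (D w) = det (E w) / det V * (w - z0) powi int (vec.dim ?K)"
      using det_V by (simp add: card_I field_simps)
  qed auto
qed

section \<open>Transport of dimension to carrier-based vector spaces\<close>

lemma field_complex_field: "field complex_field"
proof -
  have "abelian_group complex_field"
    by (rule abelian_groupI) (auto simp: complex_field_def intro: exI [of _ "- _"])
  moreover have "comm_monoid complex_field"
    by (rule comm_monoidI) (auto simp: complex_field_def)
  ultimately interpret cring complex_field
    by (rule cringI) (auto simp: complex_field_def algebra_simps)
  show ?thesis
  proof (rule cring_fieldI2)
    show "\<exists>b\<in>carrier complex_field. a \<otimes>\<^bsub>complex_field\<^esub> b = \<one>\<^bsub>complex_field\<^esub>"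
      if "a \<noteq> \<zero>\<^bsub>complex_field\<^esub>" for a
      using that by (intro bexI [of _ "inverse a"]) (auto simp: complex_field_def)
  qed (simp add: complex_field_def)
qed

text \<open>The axioms are pulled back along \<phi>, and the image of a basis of \<open>K\<close> is
  a basis. This links kernels of matrices, which are subspaces of a Cartesian space, with
  eigenspaces, which are records with an explicit carrier.\<close>

lemma vectorspace_of_linear_bijection:
  fixes V :: "(complex, 'c, 'd) module_scheme" and \<phi> :: "complex ^ 'k \<Rightarrow> 'c"
  assumes K: "vec.subspace K" and bij: "bij_betw \<phi> K (carrier V)"
    and add: "\<And>x y. x \<in> K \<Longrightarrow> y \<in> K \<Longrightarrow> \<phi> (x + y) = \<phi> x \<oplus>\<^bsub>V\<^esub> \<phi> y"
    and scale: "\<And>c x. x \<in> K \<Longrightarrow> \<phi> (c *s x) = c \<odot>\<^bsub>V\<^esub> \<phi> x"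
    and zero: "\<phi> 0 = \<zero>\<^bsub>V\<^esub>"
  shows "vectorspace complex_field V"
    and "vectorspace.fin_dim complex_field V"
    and "vectorspace.dim complex_field V = vec.dim K"
proof -
  have inj: "inj_on \<phi> K" and carrier: "carrier V = \<phi> ` K"
    using bij by (auto simp: bij_betw_def)
  note clo = vec.subspace_0 [OF K] vec.subspace_add [OF K] vec.subspace_scale [OF K]
  have cf: "carrier complex_field = UNIV" "a \<oplus>\<^bsub>complex_field\<^esub> b = a + b"
    "a \<otimes>\<^bsub>complex_field\<^esub> b = a * b" "\<one>\<^bsub>complex_field\<^esub> = 1" "\<zero>\<^bsub>complex_field\<^esub> = 0" for a b
    by (simp_all add: complex_field_def)
  have "abelian_group V"
  proof (rule abelian_groupI)
    fix x assume "x \<in> carrier V"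
    then obtain x' where x: "x' \<in> K" "x = \<phi> x'"
      by (auto simp: carrier)
    then have "\<phi> (- x') \<oplus>\<^bsub>V\<^esub> x = \<zero>\<^bsub>V\<^esub>" "- x' \<in> K"
      using add [of "- x'" x'] vec.subspace_neg [OF K x(1)] by (simp_all add: zero)
    then show "\<exists>y\<in>carrier V. y \<oplus>\<^bsub>V\<^esub> x = \<zero>\<^bsub>V\<^esub>"
      by (auto simp: carrier)
    show "\<zero>\<^bsub>V\<^esub> \<oplus>\<^bsub>V\<^esub> x = x"
      using x add [OF clo(1) x(1)] by (simp add: zero)
  qed (auto simp: carrier zero [symmetric] add [symmetric] clo add_ac)
  then have "module complex_field V"
    by (intro moduleI fieldE(1) [OF field_complex_field])
      (auto simp: carrier cf add [symmetric] scale [symmetric] clo vec.scale_left_distrib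
        vec.scale_right_distrib field.axioms cring.axioms domain.axioms
        intro: field.axioms(1) [OF field_complex_field])
  then show "vectorspace complex_field V"
    by (simp add: vectorspace_def field_complex_field)
  then interpret vectorspace complex_field V .
  obtain B where B: "B \<subseteq> K" "vec.independent B" "K \<subseteq> vec.span B" "card B = vec.dim K"
    using vec.basis_exists by blast
  have fin: "finite B"
    by (rule vec.finiteI_independent [OF B(2)])
  \<comment> \<open>Injectivity of \<phi> on \<open>K\<close> keeps distinct members of
    \<open>F\<close> distinct, so no two terms of the combination merge.\<close>
  have lincomb: "lincomb a (\<phi> ` F) = \<phi> (\<Sum>b\<in>F. a (\<phi> b) *s b)" if "finite F" "F \<subseteq> K" for a F
    using that
  proof (induction F)
    case empty
    then show ?case
      by (simp add: lincomb_def zero)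
  next
    case (insert b F)
    then have b: "b \<in> K" "F \<subseteq> K" "\<phi> b \<notin> \<phi> ` F"
      using inj by (auto simp: inj_on_def)
    have "lincomb a (insert (\<phi> b) (\<phi> ` F)) = a (\<phi> b) \<odot>\<^bsub>V\<^esub> \<phi> b \<oplus>\<^bsub>V\<^esub> lincomb a (\<phi> ` F)"
      unfolding lincomb_def
      by (rule finsum_insert) (use insert b in \<open>auto simp: carrier cf scale [symmetric] clo\<close>)
    also have "\<dots> = \<phi> (a (\<phi> b) *s b + (\<Sum>b\<in>F. a (\<phi> b) *s b))"
      using insert b by (simp add: add clo scale vec.subspace_sum [OF K] subset_iff)
    finally show ?case
      using insert by simp
  qed
  have indpt: "lin_indpt (\<phi> ` B)"
  proof
    assume "lin_dep (\<phi> ` B)"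
    then obtain A a w where A: "finite A" "A \<subseteq> \<phi> ` B" "lincomb a A = \<zero>\<^bsub>V\<^esub>" "w \<in> A" "a w \<noteq> 0"
      by (auto simp: lin_dep_def cf)
    then obtain F where F: "F \<subseteq> B" "A = \<phi> ` F"
      by (meson subset_imageE)
    have finF: "finite F"
      using F(1) fin by (rule finite_subset)
    have "\<phi> (\<Sum>b\<in>F. a (\<phi> b) *s b) = \<phi> 0"
      using A(3) lincomb [OF finF, of a] F B(1) by (auto simp: zero)
    then have "(\<Sum>b\<in>F. a (\<phi> b) *s b) = 0"
      using F B(1) by (intro inj_onD [OF inj]) (auto intro!: clo vec.subspace_sum [OF K])
    then have "a (\<phi> b) = 0" if "b \<in> F" for b
      using vec.independentD [OF B(2) finF F(1), of "\<lambda>b. a (\<phi> b)"] that by blast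
    then show False
      using A F by auto
  qed
  have gen: "span (\<phi> ` B) = carrier V"
  proof
    show "span (\<phi> ` B) \<subseteq> carrier V"
      using B(1) by (intro span_is_subset2) (auto simp: carrier)
    show "carrier V \<subseteq> span (\<phi> ` B)"
    proof
      fix y assume "y \<in> carrier V"
      then obtain x where x: "x \<in> K" "y = \<phi> x"
        by (auto simp: carrier)
      then have "x \<in> vec.span B"
        using B(3) by blast
      then obtain u where u: "x = (\<Sum>b\<in>B. u b *s b)"
        using fin by (auto simp: vec.span_finite)
      have "lincomb (\<lambda>z. u (inv_into B \<phi> z)) (\<phi> ` B) = \<phi> x"
        using inj_on_subset [OF inj B(1)] lincomb [OF fin B(1)] by (simp add: u inv_into_f_f)
      then show "y \<in> span (\<phi> ` B)"
        using fin x by (auto simp: span_def cf intro!: exI [of _ "\<lambda>z. u (inv_into B \<phi> z)"] exI [of _ "\<phi> ` B"])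
    qed
  qed
  have basis: "basis (\<phi> ` B)"
    using indpt gen B(1) by (auto simp: basis_def carrier)
  show "fin_dim"
    using fin gen B(1) by (auto simp: fin_dim_def carrier intro!: exI [of _ "\<phi> ` B"])
  show "dim = vec.dim K"
    using dim_basis [OF _ basis] fin card_image [OF inj_on_subset [OF inj B(1)]] B(4) by simp
qed


section \<open>The weighted sequence space\<close>

lemma Rshift_add: "Rshift (\<lambda>n. y n + z n) n = Rshift y n + Rshift z n"
  by (simp add: Rshift_def vec_eq_iff split: sum.split)

lemma Rshift_diff: "Rshift (\<lambda>n. y n - z n) n = Rshift y n - Rshift z n"
  by (simp add: Rshift_def vec_eq_iff split: sum.split)

lemma Rshift_scale: "Rshift (\<lambda>n. c *s y n) n = c *s Rshift y n"
  by (simp add: Rshift_def vec_eq_iff split: sum.split)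

lemma Rshift_0 [simp]: "Rshift (\<lambda>n. 0) n = 0"
  by (simp add: Rshift_def vec_eq_iff split: sum.split)

section \<open>Nonnegative Hermitian forms\<close>

lemma nonneg_hermitian_form_add:
  assumes "nonneg_hermitian X"
  shows "Re (hdot (x + y) (X *v (x + y))) =
    Re (hdot x (X *v x)) + Re (hdot y (X *v y)) + 2 * Re (hdot x (X *v y))"
proof -
  have "cnj (hdot x (X *v y)) = hdot y (X *v x)"
    using assms by (simp add: cnj_hdot hdot_matrix_left nonneg_hermitian_def hermitian_def)
  then have "Re (hdot y (X *v x)) = Re (hdot x (X *v y))"
    by (auto dest: arg_cong [of _ _ Re])
  then show ?thesis
    by (simp add: matrix_vector_right_distrib hdot_add_left hdot_add_right)
qed

lemma nonneg_hermitian_form_scale: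
  "Re (hdot (c *s x) (X *v (c *s x))) = (cmod c)\<^sup>2 * Re (hdot x (X *v x))"
proof -
  have "hdot (c *s x) (X *v (c *s x)) = (cnj c * c) * hdot x (X *v x)"
    by (simp add: matrix_vector_scale_right hdot_scale_left hdot_scale_right)
  also have "cnj c * c = of_real ((cmod c)\<^sup>2)"
    by (metis complex_norm_square mult.commute)
  finally show ?thesis
    by simp
qed

text \<open>Nonnegativity of the form at \<open>x + c y\<close> for \<open>c\<close> among 1, -1,
  \<open>\<i>\<close>, \<open>- \<i>\<close> bounds the real and the imaginary part of the mixed
  term by half of the right-hand side each. The additive form suits summability arguments.\<close>

lemma nonneg_hermitian_form_bound:
  assumes X: "nonneg_hermitian X"
  shows "cmod (hdot x (X *v y)) \<le> Re (hdot x (X *v x)) + Re (hdot y (X *v y))"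
proof -
  have *: "0 \<le> Re (hdot x (X *v x)) + Re (hdot y (X *v y)) + 2 * Re (c * hdot x (X *v y))"
    if "cmod c = 1" for c
  proof -
    have "0 \<le> Re (hdot (x + c *s y) (X *v (x + c *s y)))"
      using X by (auto simp: nonneg_hermitian_def)
    then show ?thesis
      using that nonneg_hermitian_form_scale [of c y X]
      by (simp only: nonneg_hermitian_form_add [OF X])
        (simp add: matrix_vector_scale_right hdot_scale_right)
  qed
  have "cmod (hdot x (X *v y)) \<le> \<bar>Re (hdot x (X *v y))\<bar> + \<bar>Im (hdot x (X *v y))\<bar>"
    by (rule cmod_le)
  then show ?thesis
    using * [of 1] * [of "-1"] * [of \<i>] * [of "- \<i>"] by simp
qed

lemma nonneg_hermitian_form_real:
  assumes "nonneg_hermitian X"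
  shows "hdot x (X *v x) = of_real (Re (hdot x (X *v x)))"
proof -
  have "cnj (hdot x (X *v x)) = hdot x (X *v x)"
    using assms by (simp add: cnj_hdot hdot_matrix_left nonneg_hermitian_def hermitian_def)
  then show ?thesis
    by (metis Reals_cnj_iff of_real_Re)
qed

text \<open>If the form vanishes at \<open>x\<close>, it vanishes at all multiples of
  \<open>x\<close>; the bound for the mixed term with \<open>y = X x\<close> then stays fixed while
  the term itself grows with the multiple.\<close>

lemma nonneg_hermitian_form_eq_0_iff:
  assumes X: "nonneg_hermitian X"
  shows "Re (hdot x (X *v x)) = 0 \<longleftrightarrow> X *v x = 0"
proof
  assume 0: "Re (hdot x (X *v x)) = 0"
  define y where "y = X *v x"
  define b where "b = Re (hdot y (X *v y))"
  have b: "0 \<le> b"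
    using X by (auto simp: b_def nonneg_hermitian_def)
  have h: "hdot x (X *v y) = hdot y y"
    using X by (simp add: hdot_matrix_right nonneg_hermitian_def hermitian_def y_def)
  have "hdot y y = 0"
  proof (rule ccontr)
    assume nz: "hdot y y \<noteq> 0"
    \<comment> \<open>Chosen so that the scaled mixed term has modulus \<open>b + 1\<close>,
      exceeding its bound \<open>b\<close>.\<close>
    define s where "s = (b + 1) / cmod (hdot y y)"
    have "cmod (hdot (of_real s *s x) (X *v y)) \<le> b"
      using nonneg_hermitian_form_bound [OF X, of "of_real s *s x" y] nonneg_hermitian_form_scale [of "of_real s" x X]
      by (simp add: 0 b_def)
    then have "\<bar>s\<bar> * cmod (hdot y y) \<le> b"
      by (simp add: hdot_scale_left norm_mult h)
    moreover have "\<bar>s\<bar> = s"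
      using b by (simp add: s_def)
    ultimately show False
      using nz by (simp add: s_def)
  qed
  then have "(\<Sum>i\<in>UNIV. (cmod (y $ i))\<^sup>2) = 0"
    unfolding hdot_def
    by (simp add: complex_norm_square [symmetric] mult.commute flip: of_real_power of_real_sum)
  then show "X *v x = 0"
    by (simp add: sum_nonneg_eq_0_iff vec_eq_iff y_def)
qed simp

section \<open>Square-summable sequences and their quotient\<close>

locale nonneg_weight =
  fixes W :: "int \<Rightarrow> 'm::finite cmat2"
  assumes W_nonneg: "nonneg_hermitian (W n)"
begin

lemma Wdens_nonneg [simp]: "0 \<le> Wdens W y n"
  using W_nonneg by (auto simp: Wdens_def nonneg_hermitian_def)

lemma Wdens_eq_0_iff: "Wdens W y n = 0 \<longleftrightarrow> W n *v Rshift y n = 0"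
  unfolding Wdens_def by (rule nonneg_hermitian_form_eq_0_iff [OF W_nonneg])

lemma Wdens_scale: "Wdens W (\<lambda>n. c *s y n) n = (cmod c)\<^sup>2 * Wdens W y n"
  unfolding Wdens_def Rshift_scale by (rule nonneg_hermitian_form_scale)

text \<open>The constant 3 is 1 for the diagonal terms plus 2 for the doubled mixed term.\<close>

lemma Wdens_add_le: "Wdens W (\<lambda>n. y n + z n) n \<le> 3 * (Wdens W y n + Wdens W z n)"
  using nonneg_hermitian_form_bound [OF W_nonneg, of "Rshift y n" n "Rshift z n"]
    abs_Re_le_cmod [of "hdot (Rshift y n) (W n *v Rshift z n)"]
    nonneg_hermitian_form_add [OF W_nonneg, of "Rshift y n" "Rshift z n" n]
  unfolding Wdens_def Rshift_add by (simp only:) argo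

lemma l2hat_0: "(\<lambda>n. 0) \<in> l2hat W"
  by (simp add: l2hat_def Wdens_def [abs_def])

lemma l2hat_scale: "y \<in> l2hat W \<Longrightarrow> (\<lambda>n. c *s y n) \<in> l2hat W"
  by (simp add: l2hat_def Wdens_scale [abs_def] summable_on_cmult_right)

lemma l2hat_add:
  assumes "y \<in> l2hat W" "z \<in> l2hat W"
  shows "(\<lambda>n. y n + z n) \<in> l2hat W"
proof -
  have "(\<lambda>n. 3 * (Wdens W y n + Wdens W z n)) summable_on UNIV"
    using assms by (auto simp: l2hat_def intro!: summable_on_cmult_right summable_on_add)
  then show ?thesis
    unfolding l2hat_def mem_Collect_eq
    by (rule summable_on_comparison_test) (rule Wdens_add_le Wdens_nonneg)+
qed

lemma l2hat_diff:
  assumes "y \<in> l2hat W" "z \<in> l2hat W"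
  shows "(\<lambda>n. y n - z n) \<in> l2hat W"
proof -
  have "y n - z n = y n + (-1) *s z n" for n
    by (simp add: vec_eq_iff)
  then show ?thesis
    using l2hat_add [OF assms(1) l2hat_scale [OF assms(2), of "-1"]] by presburger
qed

lemma dnorm_eq_0_iff:
  assumes "y \<in> l2hat W"
  shows "dnorm W y = 0 \<longleftrightarrow> (\<forall>n. W n *v Rshift y n = 0)"
proof -
  have "hdot (Rshift y n) (W n *v Rshift y n) = of_real (Wdens W y n)" for n
    unfolding Wdens_def by (rule nonneg_hermitian_form_real [OF W_nonneg])
  then have "dinner W y y = of_real (\<Sum>\<^sub>\<infinity>n\<in>UNIV. Wdens W y n)"
    using assms by (auto simp: dinner_def l2hat_def intro!: infsumI has_sum_of_real has_sum_infsum)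
  then have "dnorm W y = 0 \<longleftrightarrow> (\<Sum>\<^sub>\<infinity>n\<in>UNIV. Wdens W y n) = 0"
    by (simp add: dnorm_def)
  also have "\<dots> \<longleftrightarrow> (\<forall>n. Wdens W y n = 0)"
    using assms nonneg_infsum_le_0D [of "Wdens W y" UNIV] by (auto simp: l2hat_def)
  finally show ?thesis
    by (simp add: Wdens_eq_0_iff)
qed

text \<open>The pointwise form of belonging to the same class: on \<open>l2hat\<close> a nonnegative
  density has sum zero exactly when it vanishes at every integer.\<close>

definition weight_eq :: "'m cseq \<Rightarrow> 'm cseq \<Rightarrow> bool" where
  "weight_eq y z \<longleftrightarrow> (\<forall>n. W n *v Rshift y n = W n *v Rshift z n)"

lemma mem_l2class_iff:
  assumes "y \<in> l2hat W"
  shows "z \<in> l2class W y \<longleftrightarrow> z \<in> l2hat W \<and> weight_eq z y"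
  using dnorm_eq_0_iff [OF l2hat_diff, of z y] assms
  by (auto simp: l2class_def weight_eq_def Rshift_diff matrix_vector_mult_diff_distrib)

lemma mem_l2class_self: "y \<in> l2hat W \<Longrightarrow> y \<in> l2class W y"
  by (simp add: mem_l2class_iff weight_eq_def)

lemma l2class_eq_iff:
  assumes "y \<in> l2hat W" "z \<in> l2hat W"
  shows "l2class W y = l2class W z \<longleftrightarrow> weight_eq y z"
proof
  assume "l2class W y = l2class W z"
  then show "weight_eq y z"
    using assms mem_l2class_self [OF assms(1)] by (simp add: mem_l2class_iff)
next
  assume "weight_eq y z"
  then show "l2class W y = l2class W z"
    using assms by (simp add: set_eq_iff mem_l2class_iff weight_eq_def)
qed

lemma carrier_l2W: "carrier (l2W W) = l2class W ` l2hat W"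
  and zero_l2W: "\<zero>\<^bsub>l2W W\<^esub> = l2class W (\<lambda>n. 0)"
  by (simp_all add: l2W_def)

text \<open>All members of the union coincide and both classes are nonempty, so the union collapses
  to one class.\<close>

lemma add_l2W:
  assumes "y \<in> l2hat W" "z \<in> l2hat W"
  shows "l2class W y \<oplus>\<^bsub>l2W W\<^esub> l2class W z = l2class W (\<lambda>n. y n + z n)"
proof -
  have eq: "l2class W (\<lambda>n. y' n + z' n) = l2class W (\<lambda>n. y n + z n)"
    if "y' \<in> l2class W y" "z' \<in> l2class W z" for y' z'
    using that assms
    by (subst l2class_eq_iff)
      (auto simp: mem_l2class_iff l2hat_add weight_eq_def Rshift_add matrix_vector_right_distrib)
  have "l2class W y \<oplus>\<^bsub>l2W W\<^esub> l2class W z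
      = (\<Union>y'\<in>l2class W y. \<Union>z'\<in>l2class W z. l2class W (\<lambda>n. y' n + z' n))"
    by (simp add: l2W_def)
  also have "\<dots> = (\<Union>y'\<in>l2class W y. \<Union>z'\<in>l2class W z. l2class W (\<lambda>n. y n + z n))"
    by (intro SUP_cong refl eq)
  also have "\<dots> = l2class W (\<lambda>n. y n + z n)"
    using mem_l2class_self [OF assms(1)] mem_l2class_self [OF assms(2)] by blast
  finally show ?thesis .
qed

lemma smult_l2W:
  assumes "y \<in> l2hat W"
  shows "c \<odot>\<^bsub>l2W W\<^esub> l2class W y = l2class W (\<lambda>n. c *s y n)"
proof -
  have eq: "l2class W (\<lambda>n. c *s y' n) = l2class W (\<lambda>n. c *s y n)" if "y' \<in> l2class W y" for y'
    using that assms
    by (subst l2class_eq_iff)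
      (auto simp: mem_l2class_iff l2hat_scale weight_eq_def Rshift_scale matrix_vector_scale_right)
  have "c \<odot>\<^bsub>l2W W\<^esub> l2class W y = (\<Union>y'\<in>l2class W y. l2class W (\<lambda>n. c *s y' n))"
    by (simp add: l2W_def)
  also have "\<dots> = (\<Union>y'\<in>l2class W y. l2class W (\<lambda>n. c *s y n))"
    by (intro SUP_cong refl eq)
  also have "\<dots> = l2class W (\<lambda>n. c *s y n)"
    using mem_l2class_self [OF assms] by blast
  finally show ?thesis .
qed

lemma abelian_group_l2W: "abelian_group (l2W W)"
proof (rule abelian_groupI)
  fix Y assume "Y \<in> carrier (l2W W)"
  then obtain y where y: "y \<in> l2hat W" "Y = l2class W y"
    by (auto simp: carrier_l2W)
  have "(\<lambda>n. - y n) \<in> l2hat W"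
    using l2hat_diff [OF l2hat_0 y(1)] by simp
  then show "\<exists>Z\<in>carrier (l2W W). Z \<oplus>\<^bsub>l2W W\<^esub> Y = \<zero>\<^bsub>l2W W\<^esub>"
    using y by (intro bexI [of _ "l2class W (\<lambda>n. - y n)"]) (auto simp: carrier_l2W zero_l2W add_l2W)
qed (auto simp: carrier_l2W zero_l2W add_l2W l2hat_0 l2hat_add add_ac)

section \<open>Eigenvectors of the relation as classes of solutions\<close>

lemma rel_null_rel_shift:
  assumes "T \<subseteq> carrier (l2W W) \<times> carrier (l2W W)"
  shows "rel_null (l2W W) (rel_shift (l2W W) T \<mu>) = {Y \<in> carrier (l2W W). (Y, \<mu> \<odot>\<^bsub>l2W W\<^esub> Y) \<in> T}"
proof -
  interpret abelian_group "l2W W"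
    by (rule abelian_group_l2W)
  have closed: "\<mu> \<odot>\<^bsub>l2W W\<^esub> Y \<in> carrier (l2W W)" if "Y \<in> carrier (l2W W)" for Y
    using that by (auto simp: carrier_l2W smult_l2W l2hat_scale)
  have minus_eq: "G \<ominus>\<^bsub>l2W W\<^esub> X = \<zero>\<^bsub>l2W W\<^esub> \<longleftrightarrow> G = X"
    if "G \<in> carrier (l2W W)" "X \<in> carrier (l2W W)" for G X
    using that minus_equality [of G "\<ominus>\<^bsub>l2W W\<^esub> X"] by (auto simp: a_minus_def r_neg)
  have "\<zero>\<^bsub>l2W W\<^esub> = G \<ominus>\<^bsub>l2W W\<^esub> (\<mu> \<odot>\<^bsub>l2W W\<^esub> Y) \<longleftrightarrow> G = \<mu> \<odot>\<^bsub>l2W W\<^esub> Y"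
    if "(Y, G) \<in> T" for Y G
  proof -
    have "Y \<in> carrier (l2W W)" "G \<in> carrier (l2W W)"
      using that assms by auto
    then show ?thesis
      using minus_eq closed by (simp add: eq_commute [of "\<zero>\<^bsub>l2W W\<^esub>"])
  qed
  then have "rel_null (l2W W) (rel_shift (l2W W) T \<mu>) = {Y. (Y, \<mu> \<odot>\<^bsub>l2W W\<^esub> Y) \<in> T}"
    by (auto simp: rel_null_def rel_shift_def)
  then show ?thesis
    using assms by auto
qed

lemma solution_iff_lop: "solution P W \<mu> y \<longleftrightarrow> (\<forall>n. lop P y n = W n *v Rshift (\<lambda>n. \<mu> *s y n) n)"
proof -
  have "(P n + mat \<mu> ** W n) *v Rshift y n = W n *v Rshift (\<lambda>n. \<mu> *s y n) n + P n *v Rshift y n" for n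
    by (simp add: matrix_vector_mult_add_rdistrib Rshift_scale matrix_vector_scale_right mat_matrix_vector)
  then show ?thesis
    by (simp only: solution_def lop_def diff_eq_eq)
qed

text \<open>The right-hand side \<open>W R(g)\<close> depends only on the class of \<open>g\<close>,
  so \<open>g\<close> may be replaced by \<mu> times the representative \<open>z\<close> itself; the
  equation for the pair then becomes the homogeneous system.\<close>

lemma max_rep_smult_iff:
  assumes y: "y \<in> l2hat W"
  shows "max_rep P W (l2class W y) (\<mu> \<odot>\<^bsub>l2W W\<^esub> l2class W y) z
    \<longleftrightarrow> z \<in> l2hat W \<and> weight_eq z y \<and> solution P W \<mu> z"
proof -
  have "(\<forall>g\<in>l2class W (\<lambda>n. \<mu> *s y n). \<forall>n. lop P z n = W n *v Rshift g n) \<longleftrightarrow> solution P W \<mu> z"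
    if z: "z \<in> l2hat W" "weight_eq z y"
  proof
    assume "\<forall>g\<in>l2class W (\<lambda>n. \<mu> *s y n). \<forall>n. lop P z n = W n *v Rshift g n"
    moreover have "(\<lambda>n. \<mu> *s z n) \<in> l2class W (\<lambda>n. \<mu> *s y n)"
      using z y by (auto simp: mem_l2class_iff l2hat_scale weight_eq_def Rshift_scale matrix_vector_scale_right)
    ultimately show "solution P W \<mu> z"
      by (auto simp: solution_iff_lop)
  next
    assume "solution P W \<mu> z"
    then show "\<forall>g\<in>l2class W (\<lambda>n. \<mu> *s y n). \<forall>n. lop P z n = W n *v Rshift g n"
      using z y
      by (auto simp: mem_l2class_iff l2hat_scale weight_eq_def solution_iff_lop Rshift_scale matrix_vector_scale_right)
  qed
  then show ?thesis
    using y by (auto simp: max_rep_def smult_l2W mem_l2class_iff)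
qed

lemma solution_diff:
  assumes "solution P W \<mu> y" "solution P W \<mu> z"
  shows "solution P W \<mu> (\<lambda>n. y n - z n)"
proof -
  have "Jmat *v (y (n + 1) - z (n + 1) - (y n - z n))
      = Jmat *v (y (n + 1) - y n) - Jmat *v (z (n + 1) - z n)" for n
  proof -
    have "y (n + 1) - z (n + 1) - (y n - z n) = (y (n + 1) - y n) - (z (n + 1) - z n)"
      by simp
    then show ?thesis
      by (simp only: matrix_vector_mult_diff_distrib)
  qed
  then show ?thesis
    using assms [unfolded solution_def, rule_format]
    by (simp only: solution_def Rshift_diff matrix_vector_mult_diff_distrib [of "P _ + _"] simp_thms)
qed

end

locale definite_weight = nonneg_weight W
  for W :: "int \<Rightarrow> 'm::finite cmat2" +
  fixes P :: "int \<Rightarrow> 'm cmat2"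
  assumes definite: "solution P W \<mu> y \<Longrightarrow> (\<And>n. W n *v Rshift y n = 0) \<Longrightarrow> y = (\<lambda>n. 0)"
begin

lemma solution_unique:
  assumes "solution P W \<mu> y" "solution P W \<mu> z" "weight_eq y z"
  shows "y = z"
proof -
  have "(\<lambda>n. y n - z n) = (\<lambda>n. 0)"
    by (rule definite [OF solution_diff [OF assms(1,2)]])
      (use assms(3) in \<open>simp add: weight_eq_def Rshift_diff matrix_vector_mult_diff_distrib\<close>)
  then show ?thesis
    by (simp add: fun_eq_iff)
qed

text \<open>Definiteness separates solutions by their classes, so the boundary condition on an
  eigenpair may be evaluated on the solution itself.\<close>

lemma the_rep_eq:
  assumes "y \<in> l2hat W" "solution P W \<mu> y"
  shows "the_rep P W (l2class W y) (\<mu> \<odot>\<^bsub>l2W W\<^esub> l2class W y) = y"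
  unfolding the_rep_def
proof (rule the_equality)
  show "max_rep P W (l2class W y) (\<mu> \<odot>\<^bsub>l2W W\<^esub> l2class W y) y"
    using assms by (simp add: max_rep_smult_iff weight_eq_def)
  show "z = y" if "max_rep P W (l2class W y) (\<mu> \<odot>\<^bsub>l2W W\<^esub> l2class W y) z" for z
    using that assms solution_unique [of \<mu> z y] by (simp add: max_rep_smult_iff)
qed

lemma rel_null_T_D:
  "rel_null (l2W W) (rel_shift (l2W W) (T_D P W M N) \<mu>) =
     l2class W ` {y \<in> l2hat W. solution P W \<mu> y \<and>
       M *v boundary_vec P W at_bot y - N *v boundary_vec P W at_top y = 0}"
    (is "?L = l2class W ` ?R")
proof -
  have T: "T_D P W M N \<subseteq> carrier (l2W W) \<times> carrier (l2W W)"
    by (auto simp: T_D_def max_rel_def)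
  have L_iff: "Y \<in> ?L \<longleftrightarrow> Y \<in> carrier (l2W W) \<and> \<mu> \<odot>\<^bsub>l2W W\<^esub> Y \<in> carrier (l2W W) \<and>
      (\<exists>z. max_rep P W Y (\<mu> \<odot>\<^bsub>l2W W\<^esub> Y) z) \<and>
      M *v boundary_vec P W at_bot (the_rep P W Y (\<mu> \<odot>\<^bsub>l2W W\<^esub> Y))
      - N *v boundary_vec P W at_top (the_rep P W Y (\<mu> \<odot>\<^bsub>l2W W\<^esub> Y)) = 0" for Y
    unfolding rel_null_rel_shift [OF T] unfolding T_D_def max_rel_def by blast
  have mem: "l2class W y \<in> ?L" if y: "y \<in> ?R" for y
  proof -
    have y: "y \<in> l2hat W" "solution P W \<mu> y"
      "M *v boundary_vec P W at_bot y - N *v boundary_vec P W at_top y = 0"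
      using y by auto
    have "max_rep P W (l2class W y) (\<mu> \<odot>\<^bsub>l2W W\<^esub> l2class W y) y"
      using y by (simp add: max_rep_smult_iff weight_eq_def)
    moreover have "\<mu> \<odot>\<^bsub>l2W W\<^esub> l2class W y \<in> carrier (l2W W)"
      using y by (simp add: carrier_l2W smult_l2W l2hat_scale)
    moreover have "l2class W y \<in> carrier (l2W W)"
      using y by (simp add: carrier_l2W)
    ultimately show ?thesis
      unfolding L_iff the_rep_eq [OF y(1,2)] using y(3) by blast
  qed
  have "Y \<in> l2class W ` ?R" if Y: "Y \<in> ?L" for Y
  proof -
    from Y obtain y z where y: "y \<in> l2hat W" "Y = l2class W y"
      and z: "max_rep P W (l2class W y) (\<mu> \<odot>\<^bsub>l2W W\<^esub> l2class W y) z"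
      unfolding L_iff carrier_l2W by blast
    then have z: "z \<in> l2hat W" "weight_eq z y" "solution P W \<mu> z"
      by (simp_all add: max_rep_smult_iff)
    then have "Y = l2class W z"
      using y l2class_eq_iff [OF z(1) y(1)] by simp
    moreover from this have "M *v boundary_vec P W at_bot z - N *v boundary_vec P W at_top z = 0"
      using Y z unfolding L_iff by (simp only: the_rep_eq)
    ultimately show ?thesis
      using z by blast
  qed
  with mem show ?thesis
    by blast
qed

end


section \<open>Transfer matrices and the Lagrange identity\<close>

lemma matrix_mul_add_left: "(X + Y) ** Z = X ** Z + Y ** (Z :: 'a::semiring_1 ^ 'n ^ 'm)"
  by (simp add: vec_eq_iff matrix_matrix_mult_def distrib_right sum.distrib)

lemma matrix_vector_mult_axis_nth: "(X *v axis j 1) $ i = (X $ i $ j :: 'a::semiring_1)"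
  by (simp add: matrix_vector_mult_def axis_def if_distrib [of "\<lambda>z. _ * z"] cong: if_cong)

lemma mat_mult_nth: "(mat c ** X) $ i $ j = c * (X $ i $ j :: 'a::comm_ring_1)"
  by (simp add: matrix_matrix_mult_def mat_def if_distrib [of "\<lambda>z. z * _"] cong: if_cong)

lemma hdot_Plus: "hdot x y = (\<Sum>a\<in>UNIV. cnj (x $ Inl a) * y $ Inl a) + (\<Sum>a\<in>UNIV. cnj (x $ Inr a) * y $ Inr a)"
  by (simp add: hdot_def sum_UNIV_Plus)

lemma block_mat_vector_nth:
  "(block_mat X Y Z V *v x) $ Inl a = (X *v (\<chi> a. x $ Inl a)) $ a + (Y *v (\<chi> a. x $ Inr a)) $ a"
  "(block_mat X Y Z V *v x) $ Inr a = (Z *v (\<chi> a. x $ Inl a)) $ a + (V *v (\<chi> a. x $ Inr a)) $ a"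
  by (simp_all add: matrix_vector_mult_def sum_UNIV_Plus)

lemma block_mat_add: "block_mat X Y Z V + block_mat X' Y' Z' V' = block_mat (X + X') (Y + Y') (Z + Z') (V + V')"
  by (simp add: vec_eq_iff block_mat_def split: sum.split)

lemma block_mat_diff: "block_mat X Y Z V - block_mat X' Y' Z' V' = block_mat (X - X') (Y - Y') (Z - Z') (V - V')"
  by (simp add: vec_eq_iff block_mat_def split: sum.split)

lemma Jmat_vector_nth: "(Jmat *v x) $ Inl a = - x $ Inr a" "(Jmat *v x) $ Inr a = x $ Inl a"
  by (simp_all add: Jmat_def block_mat_vector_nth matrix_vector_minus_left)

lemma Rshift_nth [simp]: "Rshift y n $ Inl a = y (n + 1) $ Inl a" "Rshift y n $ Inr a = y n $ Inr a"
  by (simp_all add: Rshift_def)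

lemma Rshift_eq: "Rshift y n = block_mat (mat 1) 0 0 0 *v y (n + 1) + block_mat 0 0 0 (mat 1) *v y n"
proof (simp only: vec_eq_iff, intro allI)
  fix i
  show "Rshift y n $ i = (block_mat (mat 1) 0 0 0 *v y (n + 1) + block_mat 0 0 0 (mat 1) *v y n) $ i"
    by (cases i) (simp_all add: block_mat_vector_nth)
qed

text \<open>A discrete product rule: R takes u at \<open>n + 1\<close> and v at \<open>n\<close>,
  which is exactly what makes the cross terms cancel.\<close>

lemma Lagrange_identity:
  "hdot (x (n + 1)) (Jmat *v y (n + 1)) - hdot (x n) (Jmat *v y n) =
   hdot (Rshift x n) (Jmat *v (y (n + 1) - y n)) - hdot (Jmat *v (x (n + 1) - x n)) (Rshift y n)"
  by (simp add: hdot_Plus Jmat_vector_nth flip: sum.distrib sum_subtractf)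
    (auto intro!: sum.cong simp: algebra_simps)

lemma nonneg_hermitian_block_diag:
  assumes "nonneg_hermitian X" "nonneg_hermitian Y"
  shows "nonneg_hermitian (block_mat X 0 0 Y)"
proof -
  have "hdot x (block_mat X 0 0 Y *v x) =
      hdot (\<chi> a. x $ Inl a) (X *v (\<chi> a. x $ Inl a)) + hdot (\<chi> a. x $ Inr a) (Y *v (\<chi> a. x $ Inr a))" for x
    by (simp add: hdot_Plus block_mat_vector_nth) (simp add: hdot_def)
  moreover have "cadjoint (0 :: complex ^ 'a ^ 'a) = 0"
    by (simp add: vec_eq_iff)
  ultimately show ?thesis
    using assms by (auto simp: nonneg_hermitian_def hermitian_def cadjoint_block_mat)
qed

section \<open>Polynomial dependence of matrix products on the parameter\<close>

lemma quadratic_matrix_mult: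
  assumes "\<And>i j. \<exists>a b. \<forall>z. F z $ i $ j = a + b * z" "\<And>i j. \<exists>a b. \<forall>z. G z $ i $ j = a + b * z"
  shows "quadratic (\<lambda>z. (F z ** G z) $ i $ j)"
  unfolding matrix_matrix_mult_def vec_lambda_beta
proof (rule quadratic_sum)
  fix k
  obtain a b where 1: "\<And>z. F z $ i $ k = a + b * z"
    using assms(1) by blast
  obtain a' b' where 2: "\<And>z. G z $ k $ j = a' + b' * z"
    using assms(2) by blast
  show "quadratic (\<lambda>z. F z $ i $ k * G z $ k $ j)"
    unfolding 1 2 by (rule quadratic_mult_affine)
qed

lemma affine_block_mat:
  assumes "\<And>i j. \<exists>a b. \<forall>z. X z $ i $ j = a + b * z" "\<And>i j. \<exists>a b. \<forall>z. Y z $ i $ j = a + b * z"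
    "\<And>i j. \<exists>a b. \<forall>z. Z z $ i $ j = a + b * z" "\<And>i j. \<exists>a b. \<forall>z. V z $ i $ j = a + b * z"
  shows "\<exists>a b. \<forall>z. block_mat (X z) (Y z) (Z z) (V z) $ i $ j = a + b * (z :: complex)"
  using assms by (cases i; cases j) simp_all

lemma affine_const: "\<exists>a b. \<forall>z. c = a + b * (z :: complex)"
  by (intro exI [of _ c] exI [of _ 0]) simp

lemma affine_add_mat: "\<exists>a b. \<forall>z. (X + mat z ** Y) $ i $ j = a + b * (z :: complex)"
  by (intro exI [of _ "X $ i $ j"] exI [of _ "Y $ i $ j"]) (simp add: mat_mult_nth)

lemma affine_add_mat_mult: "\<exists>a b. \<forall>z. ((X + mat z ** Y) ** Z) $ i $ j = a + b * (z :: complex)"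
  using affine_add_mat [of "X ** Z" "Y ** Z" i j]
  by (simp add: matrix_mul_add_left matrix_mul_assoc)

section \<open>Limits along the integers\<close>

lemma tendsto_int_at_top:
  assumes "(\<lambda>k. f (int k)) \<longlonglongrightarrow> l"
  shows "(f \<longlongrightarrow> l) at_top"
proof -
  have "filterlim nat sequentially at_top"
    unfolding filterlim_at_top
  proof
    show "eventually (\<lambda>n. k \<le> nat n) at_top" for k
      by (rule eventually_mono [OF eventually_ge_at_top [of "int k"]]) simp
  qed
  from filterlim_compose [OF assms this] have "((\<lambda>n. f (int (nat n))) \<longlongrightarrow> l) at_top" .
  then show ?thesis
    by (rule Lim_transform_eventually) (auto intro: eventually_mono [OF eventually_ge_at_top [of 0]])
qed

lemma tendsto_int_at_bot:
  assumes "(\<lambda>k. f (- int k)) \<longlonglongrightarrow> l"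
  shows "(f \<longlongrightarrow> l) at_bot"
proof -
  have "filterlim (\<lambda>n. nat (- n)) sequentially at_bot"
    unfolding filterlim_at_top
  proof
    show "eventually (\<lambda>n. k \<le> nat (- n)) at_bot" for k
      by (rule eventually_mono [OF eventually_le_at_bot [of "- int k"]]) simp
  qed
  from filterlim_compose [OF assms this] have "((\<lambda>n. f (- int (nat (- n)))) \<longlongrightarrow> l) at_bot" .
  then show ?thesis
    by (rule Lim_transform_eventually) (auto intro: eventually_mono [OF eventually_le_at_bot [of 0]])
qed

section \<open>Transfer matrices and the fundamental matrix\<close>

primrec fwd :: "(int \<Rightarrow> 'm::finite cmat2) \<Rightarrow> nat \<Rightarrow> 'm cmat2" where
  "fwd S 0 = mat 1"
| "fwd S (Suc k) = S (int k) ** fwd S k"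

text \<open>Meant for inverse transfer matrices: the step from \<open>-k\<close> to
  \<open>-k - 1\<close> inverts the transfer matrix located at \<open>-k - 1\<close>.\<close>

primrec bwd :: "(int \<Rightarrow> 'm::finite cmat2) \<Rightarrow> nat \<Rightarrow> 'm cmat2" where
  "bwd S 0 = mat 1"
| "bwd S (Suc k) = S (- int k - 1) ** bwd S k"

locale hamiltonian_system =
  fixes A B C W1 W2 :: "int \<Rightarrow> complex ^ 'm::finite ^ 'm" and P W :: "int \<Rightarrow> 'm cmat2"
  assumes P_eq: "P n = block_mat (- C n) (cadjoint (A n)) (A n) (B n)"
    and P_hermitian: "hermitian (P n)"
    and W_eq: "W n = block_mat (W1 n) 0 0 (W2 n)"
    and W1_nonneg: "nonneg_hermitian (W1 n)" and W2_nonneg: "nonneg_hermitian (W2 n)"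
    and invertible_A: "invertible (mat 1 - A n)"
begin

sublocale nonneg_weight W
  by unfold_locales (simp add: W_eq nonneg_hermitian_block_diag W1_nonneg W2_nonneg)

definition Z where "Z n = matrix_inv (mat 1 - A n)"

lemma Z_inverse: "(mat 1 - A n) ** Z n = mat 1" "Z n ** (mat 1 - A n) = mat 1"
  using someI_ex [OF invertible_A [of n, unfolded invertible_def]]
  by (simp_all add: Z_def matrix_inv_def)

lemma cadjoint_Z_inverse:
  "(cadjoint (A n) - mat 1) ** cadjoint (Z n) = - mat 1" 
  "cadjoint (Z n) ** (cadjoint (A n) - mat 1) = - mat 1"
  using arg_cong [OF Z_inverse(1) [of n], of cadjoint] arg_cong [OF Z_inverse(2) [of n], of cadjoint]
  by (simp_all add: cadjoint_mult cadjoint_diff matrix_mul_diff_left matrix_mul_diff_right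
      equation_minus_iff [of _ "mat 1"])

text \<open>The system reads \<open>K y(n+1) = H y(n)\<close>.\<close>

definition K where "K \<mu> n = block_mat (C n + mat \<mu> ** (- W1 n)) (- mat 1) (mat 1 - A n) 0"
definition H where "H \<mu> n = block_mat 0 (cadjoint (A n) - mat 1) (mat 1) (B n + mat \<mu> ** W2 n)"
text \<open>Block inverses found by elimination. The only inverse block is \<open>Z n\<close>, free
  of \<mu>, so these matrices stay affine in \<mu> and both \<open>S\<close> and
  \<open>S_inv\<close> are quadratic.\<close>

definition K_inv where "K_inv \<mu> n = block_mat 0 (Z n) (- mat 1) ((C n + mat \<mu> ** (- W1 n)) ** Z n)"
definition H_inv where "H_inv \<mu> n = block_mat ((B n + mat \<mu> ** W2 n) ** cadjoint (Z n)) (mat 1) (- cadjoint (Z n)) 0"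

lemma K_inverse: "K_inv \<mu> n ** K \<mu> n = mat 1" "K \<mu> n ** K_inv \<mu> n = mat 1"
proof -
  show "K_inv \<mu> n ** K \<mu> n = mat 1"
    unfolding K_def K_inv_def block_mat_mult
    by (simp add: Z_inverse matrix_mul_minus_left matrix_mul_minus_right flip: matrix_mul_assoc block_mat_1)
  then show "K \<mu> n ** K_inv \<mu> n = mat 1"
    by (rule matrix_left_right_inverse1)
qed

lemma H_inverse: "H_inv \<mu> n ** H \<mu> n = mat 1" "H \<mu> n ** H_inv \<mu> n = mat 1"
proof -
  show "H \<mu> n ** H_inv \<mu> n = mat 1"
    unfolding H_def H_inv_def block_mat_mult
    by (simp add: cadjoint_Z_inverse matrix_mul_minus_left matrix_mul_minus_right flip: block_mat_1)
  then show "H_inv \<mu> n ** H \<mu> n = mat 1"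
    by (rule matrix_left_right_inverse1)
qed

definition S where "S \<mu> n = K_inv \<mu> n ** H \<mu> n"
definition S_inv where "S_inv \<mu> n = H_inv \<mu> n ** K \<mu> n"

lemma S_S_inv: "S \<mu> n ** S_inv \<mu> n = mat 1"
  unfolding S_def S_inv_def
  by (metis H_inverse(2) K_inverse(1) matrix_mul_assoc matrix_mul_lid)

lemma S_quadratic: "quadratic (\<lambda>\<mu>. S \<mu> n $ i $ j)"
  unfolding S_def K_inv_def H_def
  by (intro quadratic_matrix_mult affine_block_mat affine_const affine_add_mat affine_add_mat_mult)

lemma S_inv_quadratic: "quadratic (\<lambda>\<mu>. S_inv \<mu> n $ i $ j)"
  unfolding S_inv_def H_inv_def K_def
  by (intro quadratic_matrix_mult affine_block_mat affine_const affine_add_mat affine_add_mat_mult)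

lemma solution_iff_step: "solution P W \<mu> y \<longleftrightarrow> (\<forall>n. y (n + 1) = S \<mu> n *v y n)"
proof -
  have "Jmat *v (y (n + 1) - y n) = (P n + mat \<mu> ** W n) *v Rshift y n \<longleftrightarrow> y (n + 1) = S \<mu> n *v y n" for n
  proof -
    define Q where "Q = P n + mat \<mu> ** W n"
    have mat_W: "mat \<mu> ** W n = block_mat (mat \<mu> ** W1 n) 0 0 (mat \<mu> ** W2 n)"
      by (simp add: vec_eq_iff mat_mult_nth W_eq block_mat_def split: sum.split)
    \<comment> \<open>\<open>Rshift_eq\<close> writes R(y)(n) through projections of
      \<open>y (n + 1)\<close> and \<open>y n\<close>; collecting the two coefficients gives
      \<open>K\<close> and \<open>H\<close>.\<close>
    have K: "Jmat - Q ** block_mat (mat 1) 0 0 0 = K \<mu> n"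
      unfolding Q_def mat_W P_eq Jmat_def block_mat_add block_mat_mult block_mat_diff K_def
      by (simp add: matrix_mul_minus_right)
    have H: "Jmat + Q ** block_mat 0 0 0 (mat 1) = H \<mu> n"
      unfolding Q_def mat_W P_eq Jmat_def block_mat_add block_mat_mult H_def by simp
    have "Jmat *v (y (n + 1) - y n) = Q *v Rshift y n \<longleftrightarrow> K \<mu> n *v y (n + 1) = H \<mu> n *v y n"
      unfolding K [symmetric] H [symmetric] Rshift_eq
        matrix_vector_mult_diff_rdistrib matrix_vector_mult_add_rdistrib
        matrix_vector_mult_diff_distrib matrix_vector_right_distrib matrix_vector_mul_assoc
      by (auto simp: algebra_simps)
    also have "\<dots> \<longleftrightarrow> y (n + 1) = S \<mu> n *v y n"
      unfolding S_def by (metis K_inverse matrix_vector_mul_assoc matrix_vector_mul_lid)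
    finally show ?thesis
      unfolding Q_def .
  qed
  then show ?thesis
    by (simp add: solution_def)
qed

definition Y :: "complex \<Rightarrow> int \<Rightarrow> 'm cmat2" where
  "Y \<mu> n = (if 0 \<le> n then fwd (S \<mu>) (nat n) else bwd (S_inv \<mu>) (nat (- n)))"

lemma Y_0: "Y \<mu> 0 = mat 1"
  by (simp add: Y_def)

lemma Y_minus: "Y \<mu> (- int k) = bwd (S_inv \<mu>) k"
  by (auto simp: Y_def)

lemma Y_minus_Suc: "Y \<mu> (- int (Suc k)) = S_inv \<mu> (- int k - 1) ** Y \<mu> (- int k)"
  unfolding Y_minus by simp

lemma Y_step: "Y \<mu> (n + 1) = S \<mu> n ** Y \<mu> n"
proof (cases "0 \<le> n")
  case True
  then have "nat (n + 1) = Suc (nat n)"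
    by simp
  then show ?thesis
    using True by (simp add: Y_def)
next
  case False
  \<comment> \<open>For negative \<open>n\<close> the transfer matrix cancels the last backward
    step.\<close>
  then obtain k where k: "n = - int (Suc k)"
    using that [of "nat (- n - 1)"] by simp
  have n: "- int k - 1 = n"
    using k by simp
  have "S \<mu> n ** Y \<mu> n = (S \<mu> n ** S_inv \<mu> n) ** Y \<mu> (- int k)"
    using Y_minus_Suc [of \<mu> k] unfolding n k [symmetric] by (simp only: matrix_mul_assoc)
  then show ?thesis
    by (simp add: S_S_inv) (simp add: k)
qed

lemma solution_Y: "solution P W \<mu> (\<lambda>n. Y \<mu> n *v c)"
  by (simp add: solution_iff_step Y_step matrix_vector_mul_assoc)

lemma solution_eq_Y:
  assumes y: "solution P W \<mu> y"
  shows "y = (\<lambda>n. Y \<mu> n *v y 0)"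
proof
  fix n :: int
  have S_inv_S: "S_inv \<mu> k ** S \<mu> k = mat 1" for k
    using S_S_inv matrix_left_right_inverse1 by blast
  have y_back: "y k = S_inv \<mu> k *v y (k + 1)" for k
    using y by (simp add: solution_iff_step matrix_vector_mul_assoc S_inv_S)
  show "y n = Y \<mu> n *v y 0"
  proof (induction n rule: int_induct [where k = 0])
    case base
    show ?case by (simp add: Y_0)
  next
    case (step1 i)
    then show ?case
      using y by (simp add: solution_iff_step Y_step matrix_vector_mul_assoc)
  next
    case (step2 i)
    have "Y \<mu> (i - 1) = S_inv \<mu> (i - 1) ** Y \<mu> i"
      using Y_step [of \<mu> "i - 1"] by (simp add: matrix_mul_assoc S_inv_S)
    then show ?case
      using step2 y_back [of "i - 1"] by (simp add: matrix_vector_mul_assoc)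
  qed
qed

text \<open>Every solution is determined by its value at 0, so the definite description is well
  defined.\<close>

lemma fund_sol_eq: "fund_sol P W \<mu> i = (\<lambda>n. Y \<mu> n *v axis i 1)"
  unfolding fund_sol_def
proof (rule the_equality)
  show "solution P W \<mu> (\<lambda>n. Y \<mu> n *v axis i 1) \<and> Y \<mu> 0 *v axis i 1 = axis i 1"
    by (simp add: solution_Y Y_0)
  show "y = (\<lambda>n. Y \<mu> n *v axis i 1)" if "solution P W \<mu> y \<and> y 0 = axis i 1" for y
    using that solution_eq_Y [of \<mu> y] by simp
qed

section \<open>The Lagrange identity for solutions\<close>

text \<open>The contributions of \<open>P\<close> cancel since it is Hermitian; those of
  \<open>W\<close> combine with the difference of the parameters.\<close>

lemma Lagrange_solutions:
  assumes x: "solution P W a x" and y: "solution P W b y"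
  shows "hdot (x (n + 1)) (Jmat *v y (n + 1)) - hdot (x n) (Jmat *v y n)
    = (b - cnj a) * hdot (Rshift x n) (W n *v Rshift y n)"
proof -
  have adj: "cadjoint (P n) = P n" "cadjoint (W n) = W n"
    using P_hermitian W_nonneg by (auto simp: hermitian_def nonneg_hermitian_def)
  show ?thesis
    unfolding Lagrange_identity x [unfolded solution_def, rule_format] y [unfolded solution_def, rule_format]
    by (simp add: matrix_vector_mult_add_rdistrib mat_matrix_vector hdot_add_left hdot_add_right
        hdot_scale_left hdot_scale_right hdot_matrix_left adj algebra_simps)
qed

lemma Lagrange_Y:
  "hdot (Y a (n + 1) *v u) (Jmat *v (Y b (n + 1) *v v)) - hdot (Y a n *v u) (Jmat *v (Y b n *v v))
    = (b - cnj a) * hdot (Rshift (\<lambda>n. Y a n *v u) n) (W n *v Rshift (\<lambda>n. Y b n *v v) n)"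
  by (rule Lagrange_solutions [OF solution_Y solution_Y])

text \<open>At conjugate parameters the factor in the Lagrange identity is zero, so the form keeps
  its value from \<open>n = 0\<close>.\<close>

lemma form_Y_const: "hdot (Y (cnj b) n *v u) (Jmat *v (Y b n *v v)) = hdot u (Jmat *v v)"
proof (induction n rule: int_induct [where k = 0])
  case base
  show ?case by (simp add: Y_0)
next
  case (step1 i)
  then show ?case
    using Lagrange_Y [of "cnj b" i u b v] by simp
next
  case (step2 i)
  then show ?case
    using Lagrange_Y [of "cnj b" "i - 1" u b v] by simp
qed

lemma nth_eq_hdot: "(cadjoint X ** Jmat ** V) $ i $ j = hdot (X *v axis i 1) (Jmat *v (V *v axis j 1))"
proof -
  have "hdot (X *v axis i 1) (Jmat *v (V *v axis j 1)) = ((cadjoint X ** Jmat ** V) *v axis j 1) $ i"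
    by (simp add: hdot_matrix_left matrix_vector_mul_assoc matrix_mul_assoc hdot_axis_left)
  then show ?thesis
    by (simp add: matrix_vector_mult_axis_nth)
qed

lemma symplectic_Y: "cadjoint (Y (cnj b) n) ** Jmat ** Y b n = Jmat"
proof (simp only: vec_eq_iff, intro allI)
  fix i j
  have "(cadjoint (Y (cnj b) n) ** Jmat ** Y b n) $ i $ j = (cadjoint (mat 1) ** Jmat ** mat 1) $ i $ j"
    unfolding nth_eq_hdot form_Y_const by simp
  then show "(cadjoint (Y (cnj b) n) ** Jmat ** Y b n) $ i $ j = Jmat $ i $ j"
    by simp
qed

text \<open>The entries of the increment are Lagrange differences, hence bounded by densities of
  single solutions. Through this bound the limit circle hypothesis becomes summability of
  increments.\<close>

lemma mnorm_diff_bound: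
  "mnorm (cadjoint (Y a (n + 1)) ** Jmat ** Y b (n + 1) - cadjoint (Y a n) ** Jmat ** Y b n)
    \<le> (\<Sum>i\<in>UNIV. \<Sum>j\<in>UNIV. cmod (b - cnj a) *
        (Wdens W (\<lambda>n. Y a n *v axis i 1) n + Wdens W (\<lambda>n. Y b n *v axis j 1) n))"
  unfolding mnorm_def
proof (intro sum_mono)
  fix i j
  show "cmod ((cadjoint (Y a (n + 1)) ** Jmat ** Y b (n + 1) - cadjoint (Y a n) ** Jmat ** Y b n) $ i $ j)
    \<le> cmod (b - cnj a) * (Wdens W (\<lambda>n. Y a n *v axis i 1) n + Wdens W (\<lambda>n. Y b n *v axis j 1) n)"
    unfolding vector_minus_component nth_eq_hdot Lagrange_Y norm_mult Wdens_def
    by (intro mult_left_mono nonneg_hermitian_form_bound W_nonneg) simp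
qed

end


section \<open>Boundary values at infinity\<close>

lemma summable_int_of_summable_on:
  fixes f :: "int \<Rightarrow> real"
  assumes f: "f summable_on {1..}" and nonneg: "\<And>n. 0 \<le> f n"
  shows "summable (\<lambda>k. f (int k))"
proof -
  have "range (\<lambda>k. int k + 1) = {1..}"
  proof
    show "{1..} \<subseteq> range (\<lambda>k. int k + 1)"
    proof
      show "n \<in> range (\<lambda>k. int k + 1)" if "n \<in> {1..}" for n
        using that by (intro image_eqI [of _ _ "nat (n - 1)"]) auto
    qed
  qed auto
  then have "(f \<circ> (\<lambda>k. int k + 1)) summable_on UNIV"
    using f summable_on_reindex [of "\<lambda>k. int k + 1" UNIV f] by (simp add: inj_on_def)
  then have "summable (\<lambda>k. f (int (Suc k)))"
    by (simp add: summable_on_UNIV_nonneg_real_iff nonneg add.commute o_def)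
  \<comment> \<open>The hypothesis starts at 1; adding the single term at 0 does not affect
    summability.\<close>
  then show ?thesis
    by (rule summable_Suc_iff [THEN iffD1])
qed

lemma summable_neg_int_of_summable_on:
  fixes f :: "int \<Rightarrow> real"
  assumes f: "f summable_on {..0}" and nonneg: "\<And>n. 0 \<le> f n"
  shows "summable (\<lambda>k. f (- int k - 1))"
proof -
  have "range (\<lambda>k. - int k - 1) \<subseteq> {..0}"
    by auto
  then have "f summable_on range (\<lambda>k. - int k - 1)"
    by (rule summable_on_subset_banach [OF f])
  then have "(f \<circ> (\<lambda>k. - int k - 1)) summable_on UNIV"
    using summable_on_reindex [of "\<lambda>k. - int k - 1" UNIV f] by (simp add: inj_on_def)
  then show ?thesis
    by (simp add: summable_on_UNIV_nonneg_real_iff nonneg o_def)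
qed

lemma sum_int_telescope:
  fixes f :: "int \<Rightarrow> 'a::ab_group_add"
  shows "(\<Sum>n\<in>{- int k..<int k}. f (n + 1) - f n) = f (int k) - f (- int k)"
proof (induction k)
  case (Suc k)
  have "{- int (Suc k)..<int (Suc k)} = insert (- 1 - int k) (insert (int k) {- int k..<int k})"
    by auto
  then show ?case
    using Suc by (simp add: algebra_simps)
qed simp

section \<open>Both half lines as instances of the recursion\<close>

context hamiltonian_system
begin

sublocale plus: symplectic_recursion Jmat "\<lambda>\<mu> k. Y \<mu> (int k)" "\<lambda>\<mu> k. S \<mu> (int k)"
proof
  show "Jmat ** Jmat = (- mat 1 :: 'm cmat2)" "cadjoint Jmat = (- Jmat :: 'm cmat2)"
    by (rule Jmat_Jmat cadjoint_Jmat)+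
  show "Y l (int 0) = mat 1" for l
    by (simp add: Y_0)
  show "Y l (int (Suc n)) = S l (int n) ** Y l (int n)" for l n
    using Y_step [of l "int n"] by (simp add: add.commute)
qed (rule S_quadratic symplectic_Y)+

sublocale minus: symplectic_recursion Jmat "\<lambda>\<mu> k. Y \<mu> (- int k)" "\<lambda>\<mu> k. S_inv \<mu> (- int k - 1)"
proof
  show "Jmat ** Jmat = (- mat 1 :: 'm cmat2)" "cadjoint Jmat = (- Jmat :: 'm cmat2)"
    by (rule Jmat_Jmat cadjoint_Jmat)+
  show "Y l (- int 0) = mat 1" for l
    by (simp add: Y_0)
qed (rule S_inv_quadratic symplectic_Y Y_minus_Suc)+

end

locale limit_circle_system = hamiltonian_system A B C W1 W2 P W
  for A B C W1 W2 :: "int \<Rightarrow> complex ^ 'm::finite ^ 'm" and P W :: "int \<Rightarrow> 'm cmat2" +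
  assumes definite_sum: "\<exists>sl tl sr tr :: int. sl \<le> tl \<and> tl \<le> 0 \<and> 1 \<le> sr \<and> sr \<le> tr \<and>
      (\<forall>\<mu> y. solution P W \<mu> y \<and> y \<noteq> (\<lambda>n. 0) \<longrightarrow>
        (\<Sum>n=sl..tl. Wdens W y n) > 0 \<and> (\<Sum>n=sr..tr. Wdens W y n) > 0)"
    and lc_minf: "limit_circle_minf P W" and lc_pinf: "limit_circle_pinf P W"
begin

sublocale definite_weight W P
proof
  fix \<mu> y
  assume y: "solution P W \<mu> y" "\<And>n. W n *v Rshift y n = 0"
  from y(2) have "Wdens W y n = 0" for n
    by (simp add: Wdens_eq_0_iff)
  then show "y = (\<lambda>n. 0)"
    using definite_sum y(1) by fastforce
qed

sublocale plus: limit_circle_recursion Jmat "\<lambda>\<mu> k. Y \<mu> (int k)" "\<lambda>\<mu> k. S \<mu> (int k)"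
proof
  fix a b :: complex
  assume ab: "a \<notin> \<real>" "b \<notin> \<real>"
  have w: "summable (\<lambda>k. Wdens W (\<lambda>n. Y l n *v c) (int k))" if "l \<notin> \<real>" for l c
    using lc_pinf that
    by (intro summable_int_of_summable_on) (auto simp: limit_circle_pinf_def solution_Y)
  show "summable (\<lambda>k. mnorm (plus.X a b (Suc k) - plus.X a b k))"
  proof (rule summable_comparison_test')
    show "summable (\<lambda>k. \<Sum>i\<in>UNIV. \<Sum>j\<in>UNIV. cmod (b - cnj a) *
        (Wdens W (\<lambda>n. Y a n *v axis i 1) (int k) + Wdens W (\<lambda>n. Y b n *v axis j 1) (int k)))"
      by (intro summable_sum summable_mult summable_add w ab)
    show "norm (mnorm (plus.X a b (Suc k) - plus.X a b k)) \<le> (\<Sum>i\<in>UNIV. \<Sum>j\<in>UNIV. cmod (b - cnj a) *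
        (Wdens W (\<lambda>n. Y a n *v axis i 1) (int k) + Wdens W (\<lambda>n. Y b n *v axis j 1) (int k)))" for k
      using mnorm_diff_bound [of a "int k" b] by (simp add: plus.X_def add.commute)
  qed
qed

sublocale minus: limit_circle_recursion Jmat "\<lambda>\<mu> k. Y \<mu> (- int k)" "\<lambda>\<mu> k. S_inv \<mu> (- int k - 1)"
proof
  fix a b :: complex
  assume ab: "a \<notin> \<real>" "b \<notin> \<real>"
  have w: "summable (\<lambda>k. Wdens W (\<lambda>n. Y l n *v c) (- int k - 1))" if "l \<notin> \<real>" for l c
    using lc_minf that
    by (intro summable_neg_int_of_summable_on) (auto simp: limit_circle_minf_def solution_Y)
  show "summable (\<lambda>k. mnorm (minus.X a b (Suc k) - minus.X a b k))"
  proof (rule summable_comparison_test')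
    show "summable (\<lambda>k. \<Sum>i\<in>UNIV. \<Sum>j\<in>UNIV. cmod (b - cnj a) *
        (Wdens W (\<lambda>n. Y a n *v axis i 1) (- int k - 1) + Wdens W (\<lambda>n. Y b n *v axis j 1) (- int k - 1)))"
      by (intro summable_sum summable_mult summable_add w ab)
    fix k
    \<comment> \<open>Moving left reverses the difference in the Lagrange identity; the norm ignores
      the sign.\<close>
    have "minus.X a b (Suc k) - minus.X a b k
        = - (cadjoint (Y a (- int k - 1 + 1)) ** Jmat ** Y b (- int k - 1 + 1)
            - cadjoint (Y a (- int k - 1)) ** Jmat ** Y b (- int k - 1))"
    proof -
      have "- int (Suc k) = - int k - 1"
        by simp
      then show ?thesis
        unfolding minus.X_def by (simp only: diff_add_cancel minus_diff_eq)
    qed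
    then show "norm (mnorm (minus.X a b (Suc k) - minus.X a b k)) \<le> (\<Sum>i\<in>UNIV. \<Sum>j\<in>UNIV. cmod (b - cnj a) *
        (Wdens W (\<lambda>n. Y a n *v axis i 1) (- int k - 1) + Wdens W (\<lambda>n. Y b n *v axis j 1) (- int k - 1)))"
      using mnorm_diff_bound [of a "- int k - 1" b] by (simp only: mnorm_minus real_norm_def abs_of_nonneg mnorm_nonneg)
  qed
qed

section \<open>Boundary values of solutions and the limits of \<Theta>\<close>

lemma dform_fund_sol:
  "dform (\<lambda>n. Y \<mu> n *v c) (fund_sol P W 0 j) n = ((cadjoint (Y 0 n) ** Jmat ** Y \<mu> n) *v c) $ j"
  by (simp add: dform_def fund_sol_eq hdot_matrix_left hdot_axis_left matrix_vector_mul_assoc matrix_mul_assoc)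

lemma boundary_vec_at_top: "boundary_vec P W at_top (\<lambda>n. Y \<mu> n *v c) = plus.Xlim \<mu> *v c"
proof (simp only: vec_eq_iff, intro allI)
  fix j
  have "(\<lambda>k. dform (\<lambda>n. Y \<mu> n *v c) (fund_sol P W 0 j) (int k)) \<longlonglongrightarrow> (plus.Xlim \<mu> *v c) $ j"
    unfolding dform_fund_sol plus.X_def [symmetric]
    by (intro tendsto_vec_nth tendsto_matrix_vector_mult plus.X_tendsto tendsto_const)
  then show "boundary_vec P W at_top (\<lambda>n. Y \<mu> n *v c) $ j = (plus.Xlim \<mu> *v c) $ j"
    by (simp add: boundary_vec_def dform_lim_def tendsto_Lim tendsto_int_at_top)
qed

lemma boundary_vec_at_bot: "boundary_vec P W at_bot (\<lambda>n. Y \<mu> n *v c) = minus.Xlim \<mu> *v c"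
proof (simp only: vec_eq_iff, intro allI)
  fix j
  have "(\<lambda>k. dform (\<lambda>n. Y \<mu> n *v c) (fund_sol P W 0 j) (- int k)) \<longlonglongrightarrow> (minus.Xlim \<mu> *v c) $ j"
    unfolding dform_fund_sol minus.X_def [symmetric]
    by (intro tendsto_vec_nth tendsto_matrix_vector_mult minus.X_tendsto tendsto_const)
  then show "boundary_vec P W at_bot (\<lambda>n. Y \<mu> n *v c) $ j = (minus.Xlim \<mu> *v c) $ j"
    by (simp add: boundary_vec_def dform_lim_def tendsto_Lim tendsto_int_at_bot)
qed

lemma Theta_lim_eq: "Theta_lim P W at_top \<mu> = plus.Xlim \<mu>" "Theta_lim P W at_bot \<mu> = minus.Xlim \<mu>"
proof -
  have "Theta_lim P W F \<mu> $ j $ i = boundary_vec P W F (\<lambda>n. Y \<mu> n *v axis i 1) $ j" for F j i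
    by (simp add: Theta_lim_def boundary_vec_def fund_sol_eq)
  then show "Theta_lim P W at_top \<mu> = plus.Xlim \<mu>" "Theta_lim P W at_bot \<mu> = minus.Xlim \<mu>"
    by (simp_all add: vec_eq_iff boundary_vec_at_top boundary_vec_at_bot matrix_vector_mult_axis_nth)
qed

section \<open>Truncated norms and their limits\<close>

text \<open>The squared seminorm cut off to a half-open window, over which the Lagrange identity
  telescopes to the values at \<open>k\<close> and \<open>-k\<close>.\<close>

definition partial_norm :: "'m cseq \<Rightarrow> nat \<Rightarrow> real" where
  "partial_norm y k = (\<Sum>n\<in>{- int k..<int k}. Wdens W y n)"

text \<open>Once the window contains the left definiteness interval, its positive sum bounds the
  truncated norms from below.\<close>

lemma partial_norm_not_tendsto_0:
  assumes "c \<noteq> 0"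
  shows "\<not> partial_norm (\<lambda>n. Y \<mu> n *v c) \<longlonglongrightarrow> 0"
proof
  let ?y = "\<lambda>n. Y \<mu> n *v c"
  assume lim: "partial_norm ?y \<longlonglongrightarrow> 0"
  have "?y 0 \<noteq> 0"
    using assms by (simp add: Y_0)
  then have "?y \<noteq> (\<lambda>n. 0)"
    by (auto simp: fun_eq_iff)
  then obtain sl tl where pos: "(\<Sum>n=sl..tl. Wdens W ?y n) > 0"
    using definite_sum solution_Y by blast
  have "(\<Sum>n=sl..tl. Wdens W ?y n) \<le> partial_norm ?y k" if "nat (\<bar>sl\<bar> + \<bar>tl\<bar> + 1) \<le> k" for k
    unfolding partial_norm_def using that by (intro sum_mono2) auto
  then have "(\<Sum>n=sl..tl. Wdens W ?y n) \<le> 0"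
    by (intro LIMSEQ_le_const [OF lim]) blast
  with pos show False
    by simp
qed

text \<open>The telescoped Lagrange identity with both parameters equal. Its factor vanishes for
  real \<mu>, where the differentiated identity replaces it.\<close>

lemma partial_norm_eq:
  "(\<mu> - cnj \<mu>) * of_real (partial_norm (\<lambda>n. Y \<mu> n *v c) k) =
    hdot (Y \<mu> (int k) *v c) (Jmat *v (Y \<mu> (int k) *v c))
    - hdot (Y \<mu> (- int k) *v c) (Jmat *v (Y \<mu> (- int k) *v c))"
proof -
  let ?f = "\<lambda>n. hdot (Y \<mu> n *v c) (Jmat *v (Y \<mu> n *v c))"
  have "?f (n + 1) - ?f n = (\<mu> - cnj \<mu>) * of_real (Wdens W (\<lambda>n. Y \<mu> n *v c) n)" for n
    unfolding Lagrange_Y Wdens_def nonneg_hermitian_form_real [OF W_nonneg, symmetric] ..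
  then show ?thesis
    using sum_int_telescope [of ?f k] by (simp add: partial_norm_def sum_distrib_left)
qed

lemma Y_tendsto: "((\<lambda>l. Y l n) \<longlongrightarrow> Y z n) (at z)"
proof (intro vec_tendstoI)
  fix i j
  have "(\<lambda>l. Y l n $ i $ j) holomorphic_on UNIV"
  proof (cases "0 \<le> n")
    case True
    then show ?thesis
      using plus.Y_holomorphic [of "nat n" i j UNIV] by simp
  next
    case False
    then show ?thesis
      using minus.Y_holomorphic [of "nat (- n)" i j UNIV] by simp
  qed
  then have "continuous_on UNIV (\<lambda>l. Y l n $ i $ j)"
    by (rule holomorphic_on_imp_continuous_on)
  then show "((\<lambda>l. Y l n $ i $ j) \<longlongrightarrow> Y z n $ i $ j) (at z)"
    by (simp add: continuous_on_def)
qed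

text \<open>
  For real \<open>z\<close> the Lagrange identity carries the factor \<open>l - z\<close>, so its derivative at \<open>l = z\<close> is the norm.
\<close>

lemma partial_norm_eq_real:
  assumes z: "z \<in> \<real>"
  shows "of_real (partial_norm (\<lambda>n. Y z n *v u) k) = plus.form' z u v k - minus.form' z u v k"
proof (rule DERIV_unique)
  \<comment> \<open>The initial vector moves along \<open>v\<close> together with the parameter; the
    left argument of the form, which is conjugate-linear, stays at \<open>z\<close>.\<close>
  define c where "c l = u + (l - z) *s v" for l
  define F where "F l n = hdot (Y z n *v u) (Jmat *v (Y l n *v c l))" for l n
  define g where "g l n = hdot (Rshift (\<lambda>n. Y z n *v u) n) (W n *v Rshift (\<lambda>n. Y l n *v c l) n)" for l n
  define G where "G l = (\<Sum>n\<in>{- int k..<int k}. g l n)" for l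
  have "cnj z = z"
    using z by (simp add: Reals_cnj_iff)
  then have "F l (n + 1) - F l n = (l - z) * g l n" for l n
    unfolding F_def g_def Lagrange_Y by simp
  then have F_eq: "F l (int k) - F l (- int k) = (l - z) * G l" for l
    using sum_int_telescope [of "F l" k] by (simp add: G_def sum_distrib_left)
  have c_tendsto: "(c \<longlongrightarrow> c z) (at z)"
    unfolding c_def by (intro vec_tendstoI) (auto intro!: tendsto_eq_intros)
  have g_tendsto: "((\<lambda>l. g l n) \<longlongrightarrow> g z n) (at z)" for n
    unfolding g_def Rshift_eq
    by (intro tendsto_hdot tendsto_matrix_vector_mult tendsto_add tendsto_const Y_tendsto c_tendsto)
  \<comment> \<open>Caratheodory's criterion: the difference of the forms is \<open>l - z\<close>
    times the continuous function \<open>G\<close>, so its derivative at \<open>z\<close> is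
    \<open>G z\<close>.\<close>
  have "isCont G z"
    unfolding isCont_def G_def by (intro tendsto_sum g_tendsto)
  moreover have "G z = of_real (partial_norm (\<lambda>n. Y z n *v u) k)"
    unfolding G_def g_def partial_norm_def of_real_sum Wdens_def
      nonneg_hermitian_form_real [OF W_nonneg, symmetric]
    by (simp add: c_def)
  moreover have "(F l (int k) - F l (- int k)) - (F z (int k) - F z (- int k)) = G l * (l - z)" for l
    unfolding F_eq by simp
  ultimately show "((\<lambda>l. F l (int k) - F l (- int k)) has_field_derivative
      of_real (partial_norm (\<lambda>n. Y z n *v u) k)) (at z)"
    unfolding CARAT_DERIV by blast
  show "((\<lambda>l. F l (int k) - F l (- int k)) has_field_derivative
      plus.form' z u v k - minus.form' z u v k) (at z)"
    unfolding F_def c_def by (intro DERIV_diff plus.form_has_derivative minus.form_has_derivative)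
qed

lemma partial_norm_tendsto_real:
  assumes "z \<in> \<real>"
  shows "(\<lambda>k. complex_of_real (partial_norm (\<lambda>n. Y z n *v u) k)) \<longlonglongrightarrow>
    hdot (plus.Xlim z *v u) (Jmat *v (plus.Xlim' z *v u + plus.Xlim z *v v))
    - hdot (minus.Xlim z *v u) (Jmat *v (minus.Xlim' z *v u + minus.Xlim z *v v))"
  unfolding partial_norm_eq_real [OF assms, of u _ v]
  by (intro tendsto_diff plus.form'_tendsto minus.form'_tendsto)

text \<open>The limit circle hypothesis speaks of nonreal parameters. For real \<open>z\<close> the
  truncated norms converge by the differentiated Lagrange identity, hence are bounded, and
  nonnegative densities with bounded sums are summable.\<close>

lemma solution_l2_real:
  assumes z: "z \<in> \<real>"
  shows "(\<lambda>n. Y z n *v u) \<in> l2hat W"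
proof -
  let ?y = "\<lambda>n. Y z n *v u"
  have "Bseq (\<lambda>k. complex_of_real (partial_norm ?y k))"
    by (rule convergent_imp_Bseq) (use partial_norm_tendsto_real [OF z, of u 0] in \<open>auto simp: convergent_def\<close>)
  then obtain b where b: "norm (complex_of_real (partial_norm ?y k)) \<le> b" for k
    by (auto simp: Bseq_def)
  have "sum (Wdens W ?y) F \<le> b" if "finite F" for F
  proof -
    \<comment> \<open>Inserting 0 keeps the maximum over a nonempty set, and adding 1 compensates
      for the half-open window.\<close>
    define k where "k = nat (Max (abs ` insert 0 F) + 1)"
    have "\<bar>n\<bar> \<le> Max (abs ` insert 0 F)" if "n \<in> insert 0 F" for n
      using \<open>finite F\<close> that by (intro Max_ge) auto
    then have "F \<subseteq> {- int k..<int k}"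
      by (fastforce simp: k_def abs_le_iff)
    then have "sum (Wdens W ?y) F \<le> partial_norm ?y k"
      unfolding partial_norm_def by (intro sum_mono2) auto
    then show ?thesis
      using b [of k] by simp
  qed
  then show ?thesis
    unfolding l2hat_def mem_Collect_eq
    by (intro nonneg_bdd_above_summable_on) (auto simp: bdd_above_def)
qed

end

section \<open>The characteristic matrix D and its kernel\<close>

locale self_adjoint_boundary = limit_circle_system A B C W1 W2 P W
  for A B C W1 W2 :: "int \<Rightarrow> complex ^ 'm::finite ^ 'm" and P W :: "int \<Rightarrow> 'm cmat2" +
  fixes M N :: "'m cmat2"
  assumes rank_MN: "rank (row_join M N) = 2 * CARD('m)"
    and MJM: "M ** Jmat ** cadjoint M = N ** Jmat ** cadjoint N"
begin

definition D :: "complex \<Rightarrow> 'm cmat2" where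
  "D z = M ** minus.Xlim z - N ** plus.Xlim z"

lemma Gamma_d_eq: "Gamma_d P W M N = (\<lambda>z. det (D z))"
  by (simp add: fun_eq_iff Gamma_d_def D_def Theta_lim_eq)

lemma isotropic:
  assumes "M *v a = N *v b" "M *v a' = N *v b'"
  shows "hdot a (Jmat *v a') = hdot b (Jmat *v b')"
proof (rule boundary_space_isotropic [OF _ MJM Jmat_Jmat cadjoint_Jmat assms])
  show "rank (row_join M N) = CARD('m + 'm)"
    by (simp add: rank_MN)
qed

lemma D_mult_eq_0_iff: "D z *v c = 0 \<longleftrightarrow> M *v (minus.Xlim z *v c) = N *v (plus.Xlim z *v c)"
  by (simp add: D_def matrix_vector_mult_diff_rdistrib matrix_vector_mul_assoc)

text \<open>The boundary values of the solution at both ends satisfy the boundary condition, so by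
  isotropy the two boundary terms cancel. For nonreal \<open>z\<close> this forces the truncated
  norms to 0, contradicting definiteness.\<close>

lemma kernel_imp_real:
  assumes "D z *v c = 0" "c \<noteq> 0"
  shows "z \<in> \<real>"
proof (rule ccontr)
  assume z: "z \<notin> \<real>"
  then have nz: "z - cnj z \<noteq> 0"
    by (auto simp: Reals_cnj_iff)
  have "(\<lambda>k. (z - cnj z) * of_real (partial_norm (\<lambda>n. Y z n *v c) k)) \<longlonglongrightarrow>
      hdot (plus.Xlim z *v c) (Jmat *v (plus.Xlim z *v c))
      - hdot (minus.Xlim z *v c) (Jmat *v (minus.Xlim z *v c))"
    unfolding partial_norm_eq by (intro tendsto_diff plus.form_tendsto minus.form_tendsto)
  moreover have "hdot (minus.Xlim z *v c) (Jmat *v (minus.Xlim z *v c))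
      = hdot (plus.Xlim z *v c) (Jmat *v (plus.Xlim z *v c))"
    using assms(1) unfolding D_mult_eq_0_iff by (intro isotropic)
  ultimately have "(\<lambda>k. (z - cnj z) * of_real (partial_norm (\<lambda>n. Y z n *v c) k)) \<longlonglongrightarrow> 0"
    by simp
  from tendsto_divide [OF this tendsto_const nz]
  have "(\<lambda>k. complex_of_real (partial_norm (\<lambda>n. Y z n *v c) k)) \<longlonglongrightarrow> of_real 0"
    using nz by simp
  then have "partial_norm (\<lambda>n. Y z n *v c) \<longlonglongrightarrow> 0"
    unfolding tendsto_of_real_iff .
  then show False
    using partial_norm_not_tendsto_0 [OF assms(2)] by blast
qed

lemma D_holomorphic: "(\<lambda>z. D z $ i $ j) holomorphic_on UNIV"
  unfolding D_def matrix_matrix_mult_def vector_minus_component vec_lambda_beta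
  by (intro holomorphic_on_diff holomorphic_on_sum holomorphic_on_mult holomorphic_on_const
      plus.Xlim_holomorphic minus.Xlim_holomorphic)

lemma deriv_D: "(\<chi> i j. deriv (\<lambda>z. D z $ i $ j) z) = M ** minus.Xlim' z - N ** plus.Xlim' z"
proof -
  have d: "((\<lambda>z. minus.Xlim z $ i $ j) has_field_derivative minus.Xlim' z $ i $ j) (at z)"
    "((\<lambda>z. plus.Xlim z $ i $ j) has_field_derivative plus.Xlim' z $ i $ j) (at z)" for i j
    unfolding plus.Xlim'_def minus.Xlim'_def vec_lambda_beta
    by (rule holomorphic_derivI [OF plus.Xlim_holomorphic open_UNIV UNIV_I]
        holomorphic_derivI [OF minus.Xlim_holomorphic open_UNIV UNIV_I])+
  have "((\<lambda>z. D z $ i $ j) has_field_derivative (M ** minus.Xlim' z - N ** plus.Xlim' z) $ i $ j) (at z)" for i j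
    unfolding D_def matrix_matrix_mult_def vector_minus_component vec_lambda_beta
    by (intro DERIV_diff DERIV_sum DERIV_cmult d)
  then show ?thesis
    by (simp add: vec_eq_iff DERIV_imp_deriv)
qed

text \<open>A nonzero \<open>c0\<close> makes \<open>z\<close> real, so the differentiated Lagrange
  identity applies. Its boundary terms pair the data of \<open>c0\<close> with the data derived from
  the chain; isotropy cancels them, and the norm of the solution would be 0.\<close>

lemma no_Jordan_chain:
  assumes c0: "D z *v c0 = 0"
    and c1: "(\<chi> i j. deriv (\<lambda>z. D z $ i $ j) z) *v c0 + D z *v c1 = 0"
  shows "c0 = 0"
proof (rule ccontr)
  assume nz: "c0 \<noteq> 0"
  then have z: "z \<in> \<real>"
    using c0 kernel_imp_real by blast
  \<comment> \<open>The chain equation says precisely that the derived boundary data satisfy the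
    boundary condition.\<close>
  have "M *v (minus.Xlim' z *v c0 + minus.Xlim z *v c1) = N *v (plus.Xlim' z *v c0 + plus.Xlim z *v c1)"
    using c1 unfolding deriv_D unfolding D_def
    by (simp add: matrix_vector_mult_diff_rdistrib matrix_vector_right_distrib matrix_vector_mul_assoc algebra_simps)
  then have "hdot (minus.Xlim z *v c0) (Jmat *v (minus.Xlim' z *v c0 + minus.Xlim z *v c1))
      = hdot (plus.Xlim z *v c0) (Jmat *v (plus.Xlim' z *v c0 + plus.Xlim z *v c1))"
    using c0 unfolding D_mult_eq_0_iff by (intro isotropic)
  then have "(\<lambda>k. complex_of_real (partial_norm (\<lambda>n. Y z n *v c0) k)) \<longlonglongrightarrow> of_real 0"
    using partial_norm_tendsto_real [OF z, of c0 c1] by simp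
  then have "partial_norm (\<lambda>n. Y z n *v c0) \<longlonglongrightarrow> 0"
    unfolding tendsto_of_real_iff .
  then show False
    using partial_norm_not_tendsto_0 [OF nz] by blast
qed

section \<open>Eigenspaces as kernels of D\<close>

definition solution_class :: "complex \<Rightarrow> 'm cvec2 \<Rightarrow> 'm cseq set" where
  "solution_class z c = l2class W (\<lambda>n. Y z n *v c)"

text \<open>Solutions are parametrized by their value at 0, and the boundary condition becomes
  \<open>D z c = 0\<close>. Membership in \<open>l2hat\<close> is kept as a condition because
  \<open>z\<close> is still arbitrary.\<close>

lemma rel_null_eq:
  "rel_null (l2W W) (rel_shift (l2W W) (T_D P W M N) z) =
     solution_class z ` {c. D z *v c = 0 \<and> (\<lambda>n. Y z n *v c) \<in> l2hat W}"
proof -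
  have "{y \<in> l2hat W. solution P W z y \<and>
       M *v boundary_vec P W at_bot y - N *v boundary_vec P W at_top y = 0} =
     (\<lambda>c n. Y z n *v c) ` {c. D z *v c = 0 \<and> (\<lambda>n. Y z n *v c) \<in> l2hat W}" (is "?L = ?R")
  proof
    show "?L \<subseteq> ?R"
    proof
      fix y assume y: "y \<in> ?L"
      then have eq: "y = (\<lambda>n. Y z n *v y 0)"
        using solution_eq_Y by blast
      have "M *v boundary_vec P W at_bot (\<lambda>n. Y z n *v y 0) - N *v boundary_vec P W at_top (\<lambda>n. Y z n *v y 0) = 0"
        "(\<lambda>n. Y z n *v y 0) \<in> l2hat W"
        using y unfolding eq [symmetric] by auto
      then have "D z *v y 0 = 0 \<and> (\<lambda>n. Y z n *v y 0) \<in> l2hat W"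
        unfolding D_mult_eq_0_iff boundary_vec_at_bot boundary_vec_at_top by simp
      with eq show "y \<in> ?R"
        by blast
    qed
    show "?R \<subseteq> ?L"
    proof
      fix y assume "y \<in> ?R"
      then show "y \<in> ?L"
        by (auto simp: D_mult_eq_0_iff boundary_vec_at_bot boundary_vec_at_top solution_Y)
    qed
  qed
  then show ?thesis
    unfolding rel_null_T_D by (simp add: image_image solution_class_def)
qed

text \<open>The null space contains the zero class, so being an eigenvalue yields a nonzero class;
  its initial vector is a nonzero element of the kernel of \<open>D z\<close>.\<close>

lemma eigenvalue_real:
  assumes "rel_eigenvalue (l2W W) (T_D P W M N) z"
  shows "z \<in> \<real>"
proof -
  have "(\<lambda>n. Y z n *v 0) \<in> l2hat W"
    using l2hat_0 by simp
  then have "solution_class z 0 \<in> rel_null (l2W W) (rel_shift (l2W W) (T_D P W M N) z)"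
    unfolding rel_null_eq by (intro imageI) simp
  moreover have "solution_class z 0 = \<zero>\<^bsub>l2W W\<^esub>"
    by (simp add: solution_class_def zero_l2W)
  ultimately obtain c where "D z *v c = 0" "solution_class z c \<noteq> solution_class z 0"
    using assms unfolding rel_eigenvalue_def rel_null_eq by auto
  then show ?thesis
    using kernel_imp_real by auto
qed

text \<open>For real \<open>z\<close> all solutions are square summable, so the whole kernel of
  \<open>D z\<close> maps onto the eigenspace. Injectivity is definiteness: equal classes give equal
  solutions, hence equal values at 0.\<close>

lemma eigenspace_dim:
  assumes z: "z \<in> \<real>"
  defines "E \<equiv> eigenspace (l2W W) (T_D P W M N) z"
  shows "vectorspace.fin_dim complex_field E"
    and "vectorspace.dim complex_field E = vec.dim {c. D z *v c = 0}"
proof -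
  note l2 = solution_l2_real [OF z]
  have "inj (solution_class z)"
  proof (rule injI)
    fix c c' assume "solution_class z c = solution_class z c'"
    then have "weight_eq (\<lambda>n. Y z n *v c) (\<lambda>n. Y z n *v c')"
      by (simp add: solution_class_def l2class_eq_iff l2)
    then have "(\<lambda>n. Y z n *v c) = (\<lambda>n. Y z n *v c')"
      by (rule solution_unique [OF solution_Y solution_Y])
    from fun_cong [OF this, of 0] show "c = c'"
      by (simp add: Y_0)
  qed
  then have bij: "bij_betw (solution_class z) {c. D z *v c = 0} (carrier E)"
    by (auto simp: bij_betw_def E_def eigenspace_def rel_null_eq l2 intro: inj_on_subset)
  have sub: "vec.subspace {c. D z *v c = 0}"
    by (rule vec.linear_subspace_kernel) simp
  have add: "solution_class z (x + y) = solution_class z x \<oplus>\<^bsub>E\<^esub> solution_class z y" for x y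
    by (simp add: solution_class_def E_def eigenspace_def add_l2W l2 matrix_vector_right_distrib)
  have scale: "solution_class z (c *s x) = c \<odot>\<^bsub>E\<^esub> solution_class z x" for c x
    by (simp add: solution_class_def E_def eigenspace_def smult_l2W l2 matrix_vector_scale_right)
  have zero: "solution_class z 0 = \<zero>\<^bsub>E\<^esub>"
    by (simp add: solution_class_def E_def eigenspace_def zero_l2W)
  note transport = vectorspace_of_linear_bijection [OF sub bij add scale zero]
  show "vectorspace.fin_dim complex_field E"
    and "vectorspace.dim complex_field E = vec.dim {c. D z *v c = 0}"
    by (rule transport)+
qed

end

theorem theorem4p1:
  fixes A B C W1 W2 :: "int \<Rightarrow> complex ^ 'm::finite ^ 'm"
    and P W :: "int \<Rightarrow> 'm cmat2"
    and M N :: "'m cmat2"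
    and lam :: complex
  assumes P: "\<And>n. P n = block_mat (- C n) (cadjoint (A n)) (A n) (B n)"
    and P_herm: "\<And>n. hermitian (P n)"
    and W: "\<And>n. W n = block_mat (W1 n) 0 0 (W2 n)"
    and W1: "\<And>n. nonneg_hermitian (W1 n)"
    and W2: "\<And>n. nonneg_hermitian (W2 n)"
    and i: "\<And>n. invertible (mat 1 - A n)"
    and ii: "\<exists>sl tl sr tr :: int. sl \<le> tl \<and> tl \<le> 0 \<and> 1 \<le> sr \<and> sr \<le> tr \<and>
               (\<forall>\<mu> y. solution P W \<mu> y \<and> y \<noteq> (\<lambda>n. 0) \<longrightarrow>
                  (\<Sum>n=sl..tl. Wdens W y n) > 0 \<and> (\<Sum>n=sr..tr. Wdens W y n) > 0)"
    and lc_minf: "limit_circle_minf P W"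
    and lc_pinf: "limit_circle_pinf P W"
    and rank: "rank (row_join M N) = 2 * CARD('m)"
    and MN: "M ** Jmat ** cadjoint M = N ** Jmat ** cadjoint N"
    and eigenvalue: "rel_eigenvalue (l2W W) (T_D P W M N) lam"
  shows "vectorspace.fin_dim complex_field (eigenspace (l2W W) (T_D P W M N) lam) \<and>
         zorder (Gamma_d P W M N) lam =
           int (vectorspace.dim complex_field (eigenspace (l2W W) (T_D P W M N) lam))"
proof -
  interpret self_adjoint_boundary A B C W1 W2 P W M N
    by (unfold_locales; fact P P_herm W W1 W2 i ii lc_minf lc_pinf rank MN)
  have "zorder (Gamma_d P W M N) lam = int (vec.dim {c. D lam *v c = 0})"
    unfolding Gamma_d_eq
    by (rule zorder_det_eq_dim_kernel [OF D_holomorphic no_Jordan_chain])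
  then show ?thesis
    using eigenspace_dim [OF eigenvalue_real [OF eigenvalue]] by simp
qed

end
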